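(* Let $n\geq 2$, $k\in\{1,\dots,n-1\}$, $r:=\binom{n}{k}$. Let $f:[0,\infty)\times\mathbb{R}^n\to\mathbb{R}^n$ be continuously differentiable with respect to its second variable, with Jacobian $J(t,x):=\frac{\partial f}{\partial x}(t,x)$, and let $\Omega\subseteq\mathbb{R}^n$ be a closed and convex set such that for every $a\in\Omega$ the system $\dot x(t)=f(t,x)$ has a unique solution $x(t,a)$ with $x(0,a)=a$, and $x(t,a)\in\Omega$ for all $t\ge 0$. Suppose that there exist $\eta>0$ and a vector norm $|\cdot|$ on $\mathbb{R}^r$, with induced matrix measure $\mu$, such that $$\mu\big(J^{[k]}(t,a)\big)\le-\eta\quad\text{for all } a\in\Omega,\ t\ge 0.$$ Then the system $\dot x(t)=f(t,x)$ is $k$-contractive (on $\Omega$).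
   Context: For $M\in\mathbb{R}^{n\times m}$ and $1\le k\le\min\{n,m\}$, the $k$th multiplicative compound $M^{(k)}$ is the $\binom{n}{k}\times\binom{m}{k}$ matrix of all $k\times k$ minors of $M$, with row and column index sets (increasing $k$-sequences) ordered lexicographically. For $M\in\mathbb{R}^{n\times n}$, the $k$th additive compound is $M^{[k]}:=\frac{d}{d\varepsilon}(I+\varepsilon M)^{(k)}\big|_{\varepsilon=0}$; $J^{[k]}(t,x):=(J(t,x))^{[k]}$. For a vector norm $|\cdot|$ with induced matrix norm $\|\cdot\|$, the induced matrix measure is $\mu(M):=\lim_{\varepsilon\downarrow 0}\frac{\|I+\varepsilon M\|-1}{\varepsilon}$. Let $S^k:=\{r\in\mathbb{R}^k : r_i\ge 0,\ r_1+\dots+r_k\le 1\}$. For $a^1,\dots,a^{k+1}\in\Omega$ and $r\in S^k$ let $h(r):=\sum_{i=1}^k r_i a^i+\big(1-\sum_{i=1}^k r_i\big)a^{k+1}\in\Omega$, $w^i(t,r):=\frac{\partial}{\partial r_i}x(t,h(r))$ for $i=1,\dots,k$, and $W(t,r):=\begin{bmatrix} w^1(t,r)&\cdots&w^k(t,r)\end{bmatrix}\in\mathbb{R}^{n\times k}$. The system is called $k$-contractive if there exist $\eta>0$ and a vector norm $|\cdot|$ (on $\mathbb{R}^{\binom nk}$) such that for any $a^1,\dots,a^{k+1}\in\Omega$ and any $r\in S^k$, $|W^{(k)}(t,r)|\le\exp(-\eta t)\,|W^{(k)}(0,r)|$ for all $t\ge 0$. *)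

theory Defs
  imports "HOL-Analysis.Analysis" "HOL-Library.Fun_Lexorder"
begin

text \<open>
  Dimensions are types: a linearly ordered finite type \<open>'n\<close> stands for \<open>{1, \<dots>, n}\<close> with
  \<open>n = CARD('n)\<close>. An increasing \<open>k\<close>-sequence over \<open>{1, \<dots>, n}\<close> is a strictly monotone function
  \<open>'k \<Rightarrow> 'n\<close> with \<open>CARD('k) = k\<close>. There are \<open>n choose k\<close> of them, so the indices of a \<open>k\<close>th
  compound are the elements of any linearly ordered type \<open>'r\<close> with
  \<open>CARD('r) = CARD('n) choose CARD('k)\<close>: the element with \<open>m\<close> predecessors stands for the sequence
  with \<open>m\<close> lexicographic predecessors (see \<open>lex_seq_bij\<close> and \<open>lex_seq_less\<close> below). For other
  cardinalities of \<open>'r\<close> the definitions depending on \<open>lex_seq\<close> are meaningless.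
\<close>

definition lex_seq :: "'r::{finite,linorder} \<Rightarrow> 'k::{finite,linorder} \<Rightarrow> 'n::{finite,linorder}" where
  "lex_seq i = (THE a. strict_mono a \<and>
     card {b :: 'k \<Rightarrow> 'n. strict_mono b \<and> less_fun b a} = card {..<i})"

definition compound ::
  "'k::{finite,linorder} itself \<Rightarrow> real^('m::{finite,linorder})^('n::{finite,linorder}) \<Rightarrow>
   real^('q::{finite,linorder})^('r::{finite,linorder})" where
  "compound _ M =
     (\<chi> i j. det (\<chi> p q. M $ (lex_seq i p :: 'n) $
                           (lex_seq j q :: 'm) :: real^('k::_)^('k::_)))"

definition additive_compound ::
  "'k::{finite,linorder} itself \<Rightarrow> real^('n::{finite,linorder})^('n::_) \<Rightarrow>
   real^('r::{finite,linorder})^('r::_)" where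
  "additive_compound K M =
     vector_derivative (\<lambda>\<epsilon>. compound K (mat 1 + \<epsilon> *\<^sub>R M) :: real^('r::_)^('r::_)) (at 0)"

definition is_vector_norm :: "('a::real_vector \<Rightarrow> real) \<Rightarrow> bool" where
  "is_vector_norm N \<longleftrightarrow>
     (\<forall>x. 0 \<le> N x) \<and> (\<forall>x. N x = 0 \<longleftrightarrow> x = 0) \<and>
     (\<forall>c x. N (c *\<^sub>R x) = \<bar>c\<bar> * N x) \<and> (\<forall>x y. N (x + y) \<le> N x + N y)"

definition induced_norm :: "(real^'r \<Rightarrow> real) \<Rightarrow> real^'r^'r \<Rightarrow> real" where
  "induced_norm N A = (SUP x\<in>{x. N x = 1}. N (A *v x))"

definition matrix_measure :: "(real^'r \<Rightarrow> real) \<Rightarrow> real^'r^'r \<Rightarrow> real" where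
  "matrix_measure N A =
     Lim (at_right 0) (\<lambda>\<epsilon>. (induced_norm N (mat 1 + \<epsilon> *\<^sub>R A) - 1) / \<epsilon>)"

definition solves :: "(real \<Rightarrow> real^'n \<Rightarrow> real^'n) \<Rightarrow> real^'n \<Rightarrow> (real \<Rightarrow> real^'n) \<Rightarrow> bool" where
  "solves f a y \<longleftrightarrow>
     y 0 = a \<and> (\<forall>t\<ge>0. (y has_vector_derivative f t (y t)) (at t within {0..}))"

text \<open>The value at times \<open>t \<ge> 0\<close>, the only ones used, is determined when the solution is unique.\<close>

definition flow :: "(real \<Rightarrow> real^'n \<Rightarrow> real^'n) \<Rightarrow> real \<Rightarrow> real^'n \<Rightarrow> real^'n" where
  "flow f t a = (SOME y. solves f a y) t"

definition corner_simplex :: "(real^'k) set" where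
  "corner_simplex = {s. (\<forall>i. 0 \<le> s $ i) \<and> (\<Sum>i\<in>UNIV. s $ i) \<le> 1}"

text \<open>The points \<open>a\<^sup>1, \<dots>, a\<^sup>k\<close> are the values of \<open>a\<close>, and \<open>b\<close> is \<open>a\<^sup>k\<^sup>+\<^sup>1\<close>.\<close>

definition simplex_map :: "('k \<Rightarrow> real^'n) \<Rightarrow> real^'n \<Rightarrow> real^'k \<Rightarrow> real^'n" where
  "simplex_map a b s =
     (\<Sum>i\<in>UNIV. s $ i *\<^sub>R a i) + (1 - (\<Sum>i\<in>UNIV. s $ i)) *\<^sub>R b"

text \<open>
  Column \<open>i\<close> is the partial derivative of \<open>s \<mapsto> x(t, h(s))\<close> along the \<open>i\<close>th axis. Since \<open>h(s)\<close> need
  not lie in \<open>\<Omega>\<close> for \<open>s\<close> outside the simplex, and at a boundary point the line along the axis may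
  leave the simplex in both directions, it is taken from the Frechet derivative within the simplex.
  That derivative is unique, as the simplex is convex with nonempty interior, and at interior points
  it yields the usual partial derivatives.
\<close>

definition W_matrix ::
  "(real \<Rightarrow> real^'n \<Rightarrow> real^'n) \<Rightarrow> ('k \<Rightarrow> real^'n) \<Rightarrow> real^'n \<Rightarrow> real \<Rightarrow> real^'k \<Rightarrow> real^'k^'n" where
  "W_matrix f a b t s =
     matrix (frechet_derivative (\<lambda>u. flow f t (simplex_map a b u)) (at s within corner_simplex))"

text \<open>
  The \<open>k\<close>th compound of an \<open>n \<times> k\<close> matrix has a single column, which is identified with a vector of
  dimension \<open>n choose k\<close>.
\<close>

definition k_contractive ::
  "'k::{finite,linorder} itself \<Rightarrow> 'r::{finite,linorder} itself \<Rightarrow>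
   (real \<Rightarrow> real^('n::{finite,linorder}) \<Rightarrow> real^('n::_)) \<Rightarrow> (real^('n::_)) set \<Rightarrow> bool" where
  "k_contractive K _ f \<Omega> \<longleftrightarrow>
     (\<exists>\<eta>>0. \<exists>N :: real^('r::_) \<Rightarrow> real. is_vector_norm N \<and>
        (\<forall>(a :: 'k \<Rightarrow> real^('n::_)) b. range a \<subseteq> \<Omega> \<and> b \<in> \<Omega> \<longrightarrow>
          (\<forall>s\<in>corner_simplex. \<forall>t\<ge>0.
             N (column 1 (compound K (W_matrix f a b t s) :: real^1^('r::_)))
               \<le> exp (- \<eta> * t) * N (column 1 (compound K (W_matrix f a b 0 s) :: real^1^('r::_))))))"

text \<open>The indexing by \<open>lex_seq\<close> is the lexicographic enumeration of the increasing sequences.\<close>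

lemma less_fun_linear:
  fixes f g :: "'k::{finite,linorder} \<Rightarrow> 'n::linorder"
  assumes "f \<noteq> g"
  shows "less_fun f g \<or> less_fun g f"
proof -
  have ne: "{k. f k \<noteq> g k} \<noteq> {}" and fin: "finite {k. f k \<noteq> g k}"
    using assms by auto
  define k where "k = Min {k. f k \<noteq> g k}"
  have "f k \<noteq> g k" using Min_in[OF fin ne] by (simp add: k_def)
  moreover have "f k' = g k'" if "k' < k" for k'
    using Min_le[OF fin, of k'] that by (fastforce simp: k_def)
  ultimately show ?thesis
    by (metis less_fun_def linorder_neqE)
qed

lemma card_strict_mono:
  "card {a :: 'k::{finite,linorder} \<Rightarrow> 'n::{finite,linorder}. strict_mono a} =
     CARD('n) choose CARD('k)"
proof -
  let ?S = "{a :: 'k \<Rightarrow> 'n. strict_mono a}" and ?P = "{B :: 'n set. B \<subseteq> UNIV \<and> card B = CARD('k)}"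
  have "bij_betw range ?S ?P"
  proof (rule bij_betw_imageI)
    show "inj_on range ?S"
    proof (intro inj_onI)
      fix a b :: "'k \<Rightarrow> 'n"
      assume "a \<in> ?S" "b \<in> ?S" and eq: "range a = range b"
      then have ab: "strict_mono a" "strict_mono b" by auto
      have sl: "a = (!) (sorted_list_of_set (range a)) \<circ> (\<lambda>i. card {..<i})"
        if a: "strict_mono a" for a :: "'k \<Rightarrow> 'n"
      proof
        fix i
        let ?L = "sorted_list_of_set (UNIV :: 'k set)"
        have m: "sorted_list_of_set (range a) = map a ?L"
          using a by (intro sorted_distinct_set_unique)
            (auto simp: sorted_map distinct_map strict_mono_imp_inj_on
              intro!: sorted_wrt_mono_rel[OF _ sorted_sorted_list_of_set]
              dest: strict_mono_mono[THEN monoD])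
        obtain j where j: "j < length ?L" "?L ! j = i"
          by (metis UNIV_I finite in_set_conv_nth set_sorted_list_of_set)
        have "{..<i} = (!) ?L ` {..<j}"
        proof (intro equalityI subsetI)
          fix x assume "x \<in> {..<i}"
          then have "x < i" by simp
          moreover obtain l where l: "l < length ?L" "?L ! l = x"
            by (metis UNIV_I finite in_set_conv_nth set_sorted_list_of_set)
          ultimately have "l < j"
            using j sorted_nth_mono[OF sorted_sorted_list_of_set, of j l "UNIV :: 'k set"]
            by (metis leD linorder_le_less_linear)
          then show "x \<in> (!) ?L ` {..<j}" using l by blast
        next
          fix x assume "x \<in> (!) ?L ` {..<j}"
          then obtain l where "l < j" "x = ?L ! l" by blast
          then show "x \<in> {..<i}"
            using j sorted_wrt_nth_less[OF strict_sorted_list_of_set, of l j "UNIV :: 'k set"]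
            by auto
        qed
        moreover have "inj_on ((!) ?L) {..<j}"
          using j by (intro inj_on_nth) auto
        ultimately have "card {..<i} = j" by (simp add: card_image)
        then show "a i = ((!) (sorted_list_of_set (range a)) \<circ> (\<lambda>i. card {..<i})) i"
          using j by (simp add: m)
      qed
      show "a = b" using sl[OF ab(1)] sl[OF ab(2)] eq by metis
    qed
    show "range ` ?S = ?P"
    proof (intro equalityI subsetI)
      fix B assume "B \<in> range ` ?S"
      then show "B \<in> ?P" by (auto simp: card_image strict_mono_imp_inj_on)
    next
      fix B :: "'n set" assume B: "B \<in> ?P"
      let ?L = "sorted_list_of_set B"
      define a :: "'k \<Rightarrow> 'n" where "a i = ?L ! card {..<i}" for i
      have len: "card {..<i} < length ?L" for i :: 'k
        using B psubset_card_mono[of "UNIV :: 'k set" "{..<i}"] by auto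
      have "strict_mono a"
      proof (rule strict_monoI)
        fix i j :: 'k assume "i < j"
        then have "card {..<i} < card {..<j}"
          by (intro psubset_card_mono) auto
        then show "a i < a j"
          unfolding a_def
          using sorted_wrt_nth_less[OF strict_sorted_list_of_set] len by blast
      qed
      moreover have "range a = B"
      proof (rule card_subset_eq)
        have "a i \<in> set ?L" for i
          unfolding a_def using len[of i] by (rule nth_mem)
        then show "range a \<subseteq> B" by auto
        show "card (range a) = card B"
          using B \<open>strict_mono a\<close> by (simp add: card_image strict_mono_imp_inj_on)
      qed simp
      ultimately show "B \<in> range ` ?S" by blast
    qed
  qed
  then have "card ?S = card ?P" by (rule bij_betw_same_card)
  then show ?thesis by (simp only: n_subsets[OF finite])
qed

context
  fixes S :: "('k::{finite,linorder} \<Rightarrow> 'n::{finite,linorder}) set"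
    and rnk :: "('k \<Rightarrow> 'n) \<Rightarrow> nat"
  defines "S \<equiv> {a. strict_mono a}"
    and "rnk \<equiv> \<lambda>a. card {b. strict_mono b \<and> less_fun b a}"
  assumes card_r: "CARD('r::{finite,linorder}) = CARD('n) choose CARD('k)"
begin

private lemma rnk_less: "rnk a < rnk b" if "a \<in> S" "less_fun a b"
  unfolding rnk_def
proof (rule psubset_card_mono)
  show "{c. strict_mono c \<and> less_fun c a} \<subset> {c. strict_mono c \<and> less_fun c b}"
    using that less_fun_irrefl[of a] less_fun_trans[of _ a b] by (auto simp: S_def)
qed simp

private lemma rnk_bij: "bij_betw rnk S {..<CARD('r)}"
proof -
  have inj: "inj_on rnk S"
    using rnk_less less_fun_linear by (metis inj_onI less_irrefl)
  have "rnk a < card S" if "a \<in> S" for a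
    unfolding rnk_def using that less_fun_irrefl[of a]
    by (intro psubset_card_mono) (auto simp: S_def)
  moreover have "card S = CARD('r)"
    by (simp add: S_def card_r card_strict_mono)
  ultimately show ?thesis
    using inj by (intro bij_betw_imageI card_subset_eq) (auto simp: card_image)
qed

private lemma lex_seq_rnk:
  fixes i :: 'r
  shows "lex_seq i \<in> S \<and> rnk (lex_seq i) = card {..<i}"
proof -
  have "card {..<i} < CARD('r)"
    by (intro psubset_card_mono) auto
  then have "\<exists>!a. a \<in> S \<and> rnk a = card {..<i}"
    using rnk_bij unfolding bij_betw_def inj_on_def by (metis (no_types, lifting) imageE lessThan_iff)
  then show ?thesis
    using theI'[of "\<lambda>a. a \<in> S \<and> rnk a = card {..<i}"]
    by (simp add: lex_seq_def S_def rnk_def)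
qed

lemma lex_seq_less:
  fixes i j :: 'r
  assumes "i < j"
  shows "less_fun (lex_seq i :: 'k \<Rightarrow> 'n) (lex_seq j)"
proof -
  have "rnk (lex_seq i) < rnk (lex_seq j)"
    using assms by (simp add: lex_seq_rnk) (intro psubset_card_mono, auto)
  then show ?thesis
    using rnk_less[of "lex_seq j" "lex_seq i"] lex_seq_rnk less_fun_linear
    by (metis less_asym less_irrefl)
qed

lemma lex_seq_bij: "bij_betw (lex_seq :: 'r \<Rightarrow> 'k \<Rightarrow> 'n) UNIV {a. strict_mono a}"
proof -
  have inj: "inj (lex_seq :: 'r \<Rightarrow> 'k \<Rightarrow> 'n)"
    by (metis injI lex_seq_less less_fun_irrefl linorder_neqE)
  moreover have "range (lex_seq :: 'r \<Rightarrow> 'k \<Rightarrow> 'n) \<subseteq> {a. strict_mono a}"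
    using lex_seq_rnk by (auto simp: S_def)
  ultimately show ?thesis
    by (intro bij_betw_imageI card_subset_eq) (auto simp: card_image card_r card_strict_mono)
qed

end

end

theory Submission
  imports Defs
begin

text \<open>
  Let \<open>\<Phi>\<close> be the fundamental matrix of the variational equation \<open>\<Phi>' = J(t, x(t, h(s))) \<Phi>\<close>,
  \<open>\<Phi>(0) = I\<close>. A Gronwall estimate for \<open>x(t, b) - x(t, a) - \<Phi>(t) (b - a)\<close> shows that \<open>\<Phi>(t)\<close> is the
  derivative of the flow within \<open>\<Omega>\<close>, so \<open>W(t, s) = \<Phi>(t) H\<close> with \<open>H\<close> the constant derivative of the
  affine map \<open>h\<close>, and hence \<open>W' = J W\<close>. Differentiating minors row by row turns this into
  \<open>y' = J\<^sup>[\<^sup>k\<^sup>] y\<close> for \<open>y = W\<^sup>(\<^sup>k\<^sup>)\<close>. The upper right Dini derivative of \<open>|y|\<close> is at most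
  \<open>\<mu>(J\<^sup>[\<^sup>k\<^sup>]) |y| \<le> - \<eta> |y|\<close>, and a comparison lemma gives the exponential decay.
\<close>

subsection \<open>Comparison by Dini derivatives\<close>

text \<open>Continuous induction: nothing fails before the infimum \<open>m\<close> of the failures,
  so \<open>left\<close> gives \<open>P m\<close>, and then \<open>right\<close> clears an interval
  after \<open>m\<close>, which contradicts the choice of \<open>m\<close>. The base case is
  \<open>left\<close> at \<open>0\<close>, where the induction premise is vacuous.\<close>

lemma real_interval_induct:
  fixes P :: "real \<Rightarrow> bool"
  assumes left: "\<And>t. 0 \<le> t \<Longrightarrow> t \<le> T \<Longrightarrow> (\<And>s. 0 \<le> s \<Longrightarrow> s < t \<Longrightarrow> P s) \<Longrightarrow> P t"
    and right: "\<And>t. 0 \<le> t \<Longrightarrow> t < T \<Longrightarrow> P t \<Longrightarrow> \<forall>\<^sub>F s in at_right t. P s"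
    and t: "0 \<le> t" "t \<le> T"
  shows "P t"
proof (rule ccontr)
  assume "\<not> P t"
  define B where "B = {s. 0 \<le> s \<and> s \<le> T \<and> \<not> P s}"
  have tB: "t \<in> B" using t \<open>\<not> P t\<close> by (simp add: B_def)
  have bdd: "bdd_below B" by (auto simp: B_def bdd_below_def)
  define m where "m = Inf B"
  have m: "0 \<le> m" "m \<le> t"
    using tB bdd unfolding m_def by (auto intro!: cInf_greatest cInf_lower simp: B_def)
  have below: "P s" if "0 \<le> s" "s < m" for s
  proof (rule ccontr)
    assume "\<not> P s"
    then have "s \<in> B" using that m \<open>t \<le> T\<close> by (simp add: B_def)
    then show False using cInf_lower[OF _ bdd] that by (force simp: m_def)
  qed
  have Pm: "P m" by (rule left) (use m t below in auto)
  then have "m \<noteq> t" using \<open>\<not> P t\<close> by auto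
  then have "m < T" using m t by linarith
  from right[OF m(1) \<open>m < T\<close> Pm] obtain b where b: "b > m" "\<And>s. m < s \<Longrightarrow> s < b \<Longrightarrow> P s"
    by (auto simp: eventually_at_right_field)
  have "b \<le> m"
    unfolding m_def
  proof (rule cInf_greatest)
    fix s assume s: "s \<in> B"
    then have "m \<le> s" using bdd by (simp add: m_def cInf_lower)
    then show "b \<le> s" using s b(2)[of s] Pm by (fastforce simp: B_def)
  qed (use tB in auto)
  then show False using b by simp
qed

text \<open>The hypothesis is an upper bound for the upper right Dini derivative of \<open>g\<close>; it is only
  required near the region where the conclusion holds, which makes a priori bounds available.\<close>

lemma dini_gronwall:
  fixes g :: "real \<Rightarrow> real"
  assumes cont: "continuous_on {0..T} g" and "0 < \<delta>"
    and dini: "\<And>t \<epsilon>. 0 \<le> t \<Longrightarrow> t < T \<Longrightarrow> g t \<le> exp (k * t) * g 0 + \<delta> \<Longrightarrow> 0 < \<epsilon> \<Longrightarrow>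
                 \<forall>\<^sub>F s in at_right t. g s \<le> g t + (s - t) * (k * g t + \<epsilon>)"
    and t: "0 \<le> t" "t \<le> T"
  shows "g t \<le> exp (k * t) * g 0"
proof (rule field_le_epsilon)
  fix d :: real assume "0 < d"
  \<comment> \<open>\<open>M\<close> bounds \<open>exp (k * s) * s\<close> on \<open>{0..T}\<close>;
    the summand \<open>1\<close> keeps it positive when \<open>T = 0\<close>.\<close>
  define M where "M = exp (\<bar>k\<bar> * T) * T + 1"
  have "0 \<le> T" using t by simp
  then have M: "0 < M" by (simp add: M_def add_nonneg_pos)
  define e where "e = min d \<delta> / M"
  have e: "0 < e" using M \<open>0 < d\<close> \<open>0 < \<delta>\<close> by (simp add: e_def)
  \<comment> \<open>The barrier \<open>v\<close> satisfies
    \<open>v' = k * v + e * exp (k * s)\<close>, so where it touches \<open>g\<close> it grows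
    strictly faster than the Dini bound allows \<open>g\<close> to grow. It exceeds
    \<open>exp (k * s) * g 0\<close> by at most \<open>min d \<delta>\<close>: the bound
    \<open>d\<close> serves the final estimate, and \<open>\<delta>\<close> makes
    \<open>dini\<close> applicable at touching points.\<close>
  define v where "v s = exp (k * s) * (g 0 + e * s)" for s
  have v_le: "v s \<le> exp (k * s) * g 0 + min d \<delta>" if "0 \<le> s" "s \<le> T" for s
  proof -
    have "k * s \<le> \<bar>k\<bar> * T" using that by (intro mult_mono) auto
    then have "exp (k * s) * s \<le> exp (\<bar>k\<bar> * T) * T"
      using that by (intro mult_mono) auto
    then have "exp (k * s) * s \<le> M" by (simp add: M_def)
    then have "exp (k * s) * s * e \<le> M * e" using e by (intro mult_right_mono) auto
    also have "M * e = min d \<delta>" using M by (simp add: e_def)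
    finally show ?thesis by (simp add: v_def algebra_simps)
  qed
  have v': "(v has_real_derivative k * v s + exp (k * s) * e) (at s within X)" for s X
    unfolding v_def by (auto intro!: derivative_eq_intros simp: algebra_simps)
  have cv: "continuous_on X v" for X
    by (rule DERIV_continuous_on[OF v'])
  have "g t \<le> v t"
  proof (rule real_interval_induct[where P = "\<lambda>t. g t \<le> v t", OF _ _ t])
    fix t assume t: "0 \<le> t" "t \<le> T" and IH: "\<And>s. 0 \<le> s \<Longrightarrow> s < t \<Longrightarrow> g s \<le> v s"
    show "g t \<le> v t"
    proof (cases "t = 0")
      case False
      then have "0 < t" using t by simp
      have "at t within {0..<t} \<le> at t within {0..T}" using t by (intro at_le) auto
      then have lim: "(g \<longlongrightarrow> g t) (at t within {0..<t})" "(v \<longlongrightarrow> v t) (at t within {0..<t})"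
        using cont cv[of "{0..T}"] t by (auto simp: continuous_on_def intro: tendsto_mono)
      have "at t within {0..<t} \<noteq> bot"
        using \<open>0 < t\<close> by (simp add: trivial_limit_within islimpt_in_closure)
      moreover have "\<forall>\<^sub>F s in at t within {0..<t}. g s \<le> v s"
        using IH by (simp add: eventually_at_filter)
      ultimately show ?thesis using tendsto_le lim by blast
    qed (simp add: v_def)
  next
    fix t assume t: "0 \<le> t" "t < T" and le: "g t \<le> v t"
    have right: "at_right t \<le> at t within {0..T}"
      unfolding at_within_Icc_at_right[OF \<open>t < T\<close>, symmetric]
      using t by (intro at_le) auto
    show "\<forall>\<^sub>F s in at_right t. g s \<le> v s"
    proof (cases "g t < v t")
      case True
      have "(g \<longlongrightarrow> g t) (at_right t)" "(v \<longlongrightarrow> v t) (at_right t)"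
        using cont cv[of "{0..T}"] t by (auto simp: continuous_on_def intro: tendsto_mono[OF right])
      then have "((\<lambda>s. v s - g s) \<longlongrightarrow> v t - g t) (at_right t)" by (intro tendsto_intros)
      from order_tendstoD(1)[OF this, of 0] True show ?thesis
        by (auto elim: eventually_mono)
    next
      case False
      then have eq: "g t = v t" using le by simp
      \<comment> \<open>Half of the surplus slope of \<open>v\<close>. The other half leaves room
        for its difference quotient to converge.\<close>
      define \<epsilon> where "\<epsilon> = exp (k * t) * e / 2"
      have \<epsilon>: "0 < \<epsilon>" using e by (simp add: \<epsilon>_def)
      have "g t \<le> exp (k * t) * g 0 + \<delta>" using v_le[of t] t eq by simp
      from dini[OF t this \<epsilon>]
      have "\<forall>\<^sub>F s in at_right t. g s \<le> g t + (s - t) * (k * g t + \<epsilon>)" .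
      moreover have "((\<lambda>s. (v s - v t) / (s - t)) \<longlongrightarrow> k * v t + exp (k * t) * e) (at_right t)"
        using v'[of t "{t<..}"] by (simp add: has_field_derivative_iff)
      then have "\<forall>\<^sub>F s in at_right t. k * v t + \<epsilon> < (v s - v t) / (s - t)"
        by (rule order_tendstoD) (use e in \<open>simp add: \<epsilon>_def\<close>)
      ultimately show ?thesis
        using eventually_at_right_less[of t]
      proof eventually_elim
        case (elim s)
        then show ?case using eq by (simp add: field_simps)
      qed
    qed
  qed
  then show "g t \<le> exp (k * t) * g 0 + d" using v_le[OF t] by simp
qed

subsection \<open>Linear differential equations\<close>

text \<open>Picard iteration from the constant \<open>X0\<close>. By linearity the differences of
  successive iterates are the terms \<open>Y j\<close>, dominated by the exponential series, so
  their sum converges uniformly on the whole interval. A general bilinear \<open>B\<close> covers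
  matrix-valued unknowns.\<close>

lemma linear_ode_exists:
  fixes A :: "real \<Rightarrow> 'a::real_normed_vector" and X0 :: "'b::banach"
  assumes "bounded_bilinear B" and A: "continuous_on {0..T} A" and "0 \<le> T"
  obtains X where "X 0 = X0"
    "\<And>t. t \<in> {0..T} \<Longrightarrow> (X has_vector_derivative B (A t) (X t)) (at t within {0..T})"
proof -
  interpret B: bounded_bilinear B by fact
  define Y where "Y = rec_nat (\<lambda>_. X0) (\<lambda>_ Y t. integral {0..t} (\<lambda>s. B (A s) (Y s)))"
  have Y_0: "Y 0 t = X0" and Y_Suc: "Y (Suc j) t = integral {0..t} (\<lambda>s. B (A s) (Y j s))" for j t
    by (simp_all add: Y_def)
  have Y_cont: "continuous_on {0..T} (Y j)" for j
  proof (induction j)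
    case 0
    then show ?case by (simp add: Y_0 continuous_on_const cong: continuous_on_cong)
  next
    case (Suc j)
    have "continuous_on {0..T} (\<lambda>t. integral {0..t} (\<lambda>s. B (A s) (Y j s)))"
      by (intro indefinite_integral_continuous_1 integrable_continuous_interval
        B.continuous_on A Suc.IH)
    then show ?case by (simp add: Y_Suc[abs_def])
  qed
  have BY_cont: "continuous_on {0..T} (\<lambda>s. B (A s) (Y j s))" for j
    by (intro B.continuous_on A Y_cont)
  have Y': "(Y (Suc j) has_vector_derivative B (A t) (Y j t)) (at t within {0..T})"
    if "t \<in> {0..T}" for j t
    using integral_has_vector_derivative[OF BY_cont that] by (simp add: Y_Suc[abs_def])
  obtain K where K: "0 < K" "\<And>a b. norm (B a b) \<le> norm a * norm b * K"
    using B.pos_bounded by blast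
  obtain C where C: "0 < C" "\<And>t. t \<in> {0..T} \<Longrightarrow> norm (A t) \<le> C"
    using compact_imp_bounded[OF compact_continuous_image[OF A]]
    by (force simp: bounded_pos)
  define L where "L = C * K"
  have "0 < L" using C K by (simp add: L_def)
  have BL: "norm (B (A t) b) \<le> L * norm b" if "t \<in> {0..T}" for t b
  proof -
    have "norm (B (A t) b) \<le> norm (A t) * norm b * K" by (rule K)
    also have "\<dots> \<le> C * norm b * K" using C(2)[OF that] K by (intro mult_right_mono) auto
    finally show ?thesis by (simp add: L_def mult_ac)
  qed
  have Y_le: "norm (Y j t) \<le> norm X0 * ((L * t) ^ j / fact j)" if "t \<in> {0..T}" for j t
    using that
  proof (induction j arbitrary: t)
    case (Suc j)
    \<comment> \<open>The bound for the integrand; its antiderivative is the bound claimed for the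
      next term.\<close>
    define u where "u s = norm X0 * L ^ Suc j / fact j * s ^ j" for s
    have "((\<lambda>s. norm X0 * L ^ Suc j / fact (Suc j) * s ^ Suc j) has_real_derivative u s)
        (at s within {0..t})" for s
      by (rule DERIV_cong[OF DERIV_cmult[OF DERIV_pow]]) (simp add: u_def divide_simps del: of_nat_Suc)
    then have "(u has_integral norm X0 * L ^ Suc j / fact (Suc j) * t ^ Suc j
        - norm X0 * L ^ Suc j / fact (Suc j) * 0 ^ Suc j) {0..t}"
      using Suc.prems by (intro fundamental_theorem_of_calculus)
        (auto simp: has_real_derivative_iff_has_vector_derivative[symmetric])
    then have u: "u integrable_on {0..t}"
      "integral {0..t} u = norm X0 * ((L * t) ^ Suc j / fact (Suc j))"
      by (auto simp: has_integral_integrable integral_unique power_mult_distrib)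
    have "norm (integral {0..t} (\<lambda>s. B (A s) (Y j s))) \<le> integral {0..t} u"
    proof (rule integral_norm_bound_integral)
      show "(\<lambda>s. B (A s) (Y j s)) integrable_on {0..t}"
        using Suc.prems by (intro integrable_continuous_interval continuous_on_subset[OF BY_cont]) auto
      fix s assume s: "s \<in> {0..t}"
      then have "norm (B (A s) (Y j s)) \<le> L * norm (Y j s)" using Suc.prems by (intro BL) auto
      also have "\<dots> \<le> L * (norm X0 * ((L * s) ^ j / fact j))"
        using s Suc.prems \<open>0 < L\<close> by (intro mult_left_mono Suc.IH) auto
      also have "\<dots> = u s" by (simp add: u_def field_simps)
      finally show "norm (B (A s) (Y j s)) \<le> u s" .
    qed (rule u)
    then show ?case by (simp add: Y_Suc u)
  qed (simp add: Y_0)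
  have Y_le': "norm (Y j t) \<le> norm X0 * ((L * T) ^ j / fact j)" if "t \<in> {0..T}" for j t
    by (rule order_trans[OF Y_le[OF that]], intro mult_left_mono divide_right_mono power_mono)
      (use that \<open>0 < L\<close> in auto)
  have summ: "summable (\<lambda>j. norm X0 * ((L * T) ^ j / fact j))"
    using summable_exp[of "L * T"] by (intro summable_mult) (simp add: field_simps)
  define S where "S t = (\<Sum>j. Y j t)" for t
  have unif: "uniform_limit {0..T} (\<lambda>n t. \<Sum>j<n. Y j t) S sequentially"
    unfolding S_def by (rule Weierstrass_m_test[OF Y_le' summ])
  have Ysum: "summable (\<lambda>j. Y j t)" if "t \<in> {0..T}" for t
    using summ Y_le'[OF that] by (rule summable_comparison_test'[where N = 0])
  \<comment> \<open>Termwise differentiation of the shifted series: the error of the differentiated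
    partial sums is \<open>B (A t)\<close> applied to the tail of \<open>S\<close>, hence uniformly
    small. The constant first term \<open>X0\<close> is added back afterwards.\<close>
  have "\<exists>g. \<forall>t\<in>{0..T}. (\<lambda>j. Y (Suc j) t) sums g t \<and>
      (g has_derivative (\<lambda>h. h *\<^sub>R B (A t) (S t))) (at t within {0..T})"
  proof (rule has_derivative_series)
    show "(Y (Suc j) has_derivative (\<lambda>h. h *\<^sub>R B (A t) (Y j t))) (at t within {0..T})"
      if "t \<in> {0..T}" for j t
      using Y'[OF that] by (simp add: has_vector_derivative_def)
    show "0 \<in> {0..T}" using \<open>0 \<le> T\<close> by simp
    show "(\<lambda>j. Y (Suc j) 0) sums 0" by (simp add: Y_Suc)
    fix e :: real assume "0 < e"
    then have "0 < e / L" using \<open>0 < L\<close> by simp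
    with unif have "\<forall>\<^sub>F n in sequentially. \<forall>t\<in>{0..T}. dist (\<Sum>j<n. Y j t) (S t) < e / L"
      by (rule uniform_limitD)
    then show "\<forall>\<^sub>F n in sequentially. \<forall>t\<in>{0..T}. \<forall>h.
        norm ((\<Sum>j<n. h *\<^sub>R B (A t) (Y j t)) - h *\<^sub>R B (A t) (S t)) \<le> e * norm h"
    proof (eventually_elim, intro ballI allI)
      fix n t and h :: real
      assume *: "\<forall>t\<in>{0..T}. dist (\<Sum>j<n. Y j t) (S t) < e / L" and t: "t \<in> {0..T}"
      have "norm ((\<Sum>j<n. h *\<^sub>R B (A t) (Y j t)) - h *\<^sub>R B (A t) (S t))
          = \<bar>h\<bar> * norm (B (A t) ((\<Sum>j<n. Y j t) - S t))"
        by (simp add: B.sum_right B.diff_right scaleR_sum_right[symmetric]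
          scaleR_diff_right[symmetric])
      also have "\<dots> \<le> \<bar>h\<bar> * (L * norm ((\<Sum>j<n. Y j t) - S t))"
        by (intro mult_left_mono BL t) auto
      also have "\<dots> \<le> \<bar>h\<bar> * (L * (e / L))"
        using * t \<open>0 < L\<close> by (intro mult_left_mono) (auto simp: dist_norm less_imp_le)
      finally show "norm ((\<Sum>j<n. h *\<^sub>R B (A t) (Y j t)) - h *\<^sub>R B (A t) (S t)) \<le> e * norm h"
        using \<open>0 < L\<close> by (simp add: mult.commute)
    qed
  qed simp
  then obtain g where g: "\<And>t. t \<in> {0..T} \<Longrightarrow> (\<lambda>j. Y (Suc j) t) sums g t"
    "\<And>t. t \<in> {0..T} \<Longrightarrow> (g has_vector_derivative B (A t) (S t)) (at t within {0..T})"
    unfolding has_vector_derivative_def by metis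
  have S: "S t = X0 + g t" if "t \<in> {0..T}" for t
    using suminf_split_head[OF Ysum[OF that]] g(1)[OF that]
    by (simp add: S_def sums_iff Y_0 algebra_simps)
  show thesis
  proof (rule that[of "\<lambda>t. X0 + g t"])
    have "(\<lambda>j. 0::'b) sums g 0" using g(1)[of 0] \<open>0 \<le> T\<close> by (simp add: Y_Suc)
    then have "g 0 = 0" using sums_unique2[OF _ sums_zero] by blast
    then show "X0 + g 0 = X0" by simp
    fix t assume t: "t \<in> {0..T}"
    show "((\<lambda>t. X0 + g t) has_vector_derivative B (A t) (X0 + g t)) (at t within {0..T})"
      using has_vector_derivative_add[OF has_vector_derivative_const g(2)[OF t]] by (simp add: S[OF t])
  qed
qed

subsection \<open>Minors and compounds\<close>

lemma has_vector_derivative_vecI: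
  fixes f :: "real \<Rightarrow> 'a::euclidean_space^'n"
  assumes "\<And>i. ((\<lambda>t. f t $ i) has_vector_derivative f' $ i) (at t within S)"
  shows "(f has_vector_derivative f') (at t within S)"
  unfolding has_vector_derivative_def
proof (subst has_derivative_componentwise_within, rule ballI)
  fix b :: "'a^'n" assume "b \<in> Basis"
  then obtain i u where b: "b = axis i u" by (auto simp: Basis_vec_def)
  have "((\<lambda>t. f t $ i \<bullet> u) has_vector_derivative f' $ i \<bullet> u) (at t within S)"
    using bounded_linear.has_vector_derivative[OF bounded_linear_inner_left assms] .
  then show "((\<lambda>x. f x \<bullet> b) has_derivative (\<lambda>x. x *\<^sub>R f' \<bullet> b)) (at t within S)"
    by (simp add: b inner_axis has_vector_derivative_def)
qed

lemma has_vector_derivative_vec_nth: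
  assumes "(f has_vector_derivative f') (at t within S)"
  shows "((\<lambda>t. f t $ i) has_vector_derivative f' $ i) (at t within S)"
  using bounded_linear.has_vector_derivative[OF bounded_linear_vec_nth assms] .

text \<open>The product rule is applied to each Leibniz term. Exchanging the two sums collects the
  terms in which row \<open>p\<close> is differentiated into one determinant.\<close>

lemma has_vector_derivative_det:
  fixes A :: "real \<Rightarrow> real^'k^'k"
  assumes "(A has_vector_derivative A') (at t within S)"
  shows "((\<lambda>t. det (A t)) has_vector_derivative
           (\<Sum>p\<in>UNIV. det (\<chi> i. if i = p then A' $ i else A t $ i))) (at t within S)"
proof -
  let ?P = "{\<sigma>. \<sigma> permutes (UNIV :: 'k set)}"
  have A': "((\<lambda>t. A t $ i $ j) has_derivative (\<lambda>h. h * A' $ i $ j)) (at t within S)" for i j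
    using has_vector_derivative_vec_nth[OF has_vector_derivative_vec_nth[OF assms]]
    by (simp add: has_vector_derivative_def)
  have row_prod: "(\<Prod>i\<in>UNIV. (\<chi> i. if i = p then A' $ i else A t $ i) $ i $ \<sigma> i)
      = A' $ p $ \<sigma> p * (\<Prod>i\<in>UNIV - {p}. A t $ i $ \<sigma> i)" for p \<sigma>
    by (subst prod.remove[of _ p]) auto
  have "((\<lambda>t. \<Prod>i\<in>UNIV. A t $ i $ \<sigma> i) has_derivative
      (\<lambda>h. \<Sum>p\<in>UNIV. h * A' $ p $ \<sigma> p * (\<Prod>i\<in>UNIV - {p}. A t $ i $ \<sigma> i))) (at t within S)" for \<sigma>
    by (intro has_derivative_prod A')
  then have "((\<lambda>t. \<Sum>\<sigma>\<in>?P. of_int (sign \<sigma>) * (\<Prod>i\<in>UNIV. A t $ i $ \<sigma> i)) has_derivative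
      (\<lambda>h. \<Sum>\<sigma>\<in>?P. of_int (sign \<sigma>) *
        (\<Sum>p\<in>UNIV. h * A' $ p $ \<sigma> p * (\<Prod>i\<in>UNIV - {p}. A t $ i $ \<sigma> i)))) (at t within S)"
    by (intro has_derivative_sum has_derivative_mult_right)
  moreover have "(\<Sum>\<sigma>\<in>?P. of_int (sign \<sigma>) *
        (\<Sum>p\<in>UNIV. h * A' $ p $ \<sigma> p * (\<Prod>i\<in>UNIV - {p}. A t $ i $ \<sigma> i)))
      = h *\<^sub>R (\<Sum>p\<in>UNIV. det (\<chi> i. if i = p then A' $ i else A t $ i))" for h
    unfolding det_def row_prod sum_distrib_left scaleR_conv_of_real
    by (subst sum.swap) (simp add: mult_ac sum_distrib_left)
  ultimately show ?thesis
    by (simp add: det_def[abs_def] has_vector_derivative_def)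
qed

text \<open>A row of a product is a linear combination of rows of the right factor, and the
  determinant is linear in row \<open>p\<close>. The selection \<open>\<alpha>(p := l)\<close> may
  be unsorted or repeat a row, which is why \<open>det_select_rows\<close> is stated for arbitrary
  selections.\<close>

lemma det_row_matrix_mult:
  fixes A :: "real^'n^'m" and M :: "real^'k^'n" and \<alpha> :: "'k \<Rightarrow> 'n"
  shows "det (\<chi> i. if i = p then (A ** M) $ a else M $ \<alpha> i) =
    (\<Sum>l\<in>UNIV. A $ a $ l * det (\<chi> i. M $ (\<alpha>(p := l)) i))"
proof -
  have "(A ** M) $ a = (\<Sum>l\<in>UNIV. A $ a $ l *s M $ l)"
    by (simp add: vec_eq_iff matrix_matrix_mult_def)
  then have "det (\<chi> i. if i = p then (A ** M) $ a else M $ \<alpha> i) =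
      (\<Sum>l\<in>UNIV. det (\<chi> i. if i = p then A $ a $ l *s M $ l else M $ \<alpha> i))"
    by (simp add: det_linear_row_sum[of UNIV p "\<lambda>_ l. A $ a $ l *s M $ l"] cong: if_cong)
  also have "\<dots> = (\<Sum>l\<in>UNIV. A $ a $ l * det (\<chi> i. if i = p then M $ l else M $ \<alpha> i))"
    by (intro sum.cong refl det_row_mul)
  also have "(\<lambda>l. (\<chi> i. if i = p then M $ l else M $ \<alpha> i) :: real^'k^'k) = (\<lambda>l. \<chi> i. M $ (\<alpha>(p := l)) i)"
    by (simp add: fun_eq_iff vec_eq_iff)
  then have "(\<Sum>l\<in>UNIV. A $ a $ l * det (\<chi> i. if i = p then M $ l else M $ \<alpha> i)) =
      (\<Sum>l\<in>UNIV. A $ a $ l * det (\<chi> i. M $ (\<alpha>(p := l)) i))"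
    by metis
  finally show ?thesis .
qed

section \<open>Increasing sequences and selections of rows\<close>

text \<open>At the least disagreement \<open>m\<close>, the value \<open>a m\<close> must be taken
  by \<open>b\<close> later than \<open>m\<close>, so \<open>b m < a m\<close>; symmetrically
  \<open>a m < b m\<close>.\<close>

lemma strict_mono_range_eq_imp_eq:
  fixes a b :: "'k::{finite,linorder} \<Rightarrow> 'n::linorder"
  assumes a: "strict_mono a" and b: "strict_mono b" and eq: "range a = range b"
  shows "a = b"
proof (rule ext, rule ccontr)
  fix x assume "a x \<noteq> b x"
  let ?X = "{x. a x \<noteq> b x}"
  define m where "m = Min ?X"
  have m: "a m \<noteq> b m"
    using Min_in[of ?X] \<open>a x \<noteq> b x\<close> by (auto simp: m_def)
  have "m \<le> x" if "a x \<noteq> b x" for x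
    unfolding m_def using that by (intro Min_le) auto
  then have below: "\<And>x. x < m \<Longrightarrow> a x = b x" by (meson leD)
  obtain y z where "a m = b y" "b m = a z"
    using eq by (metis imageE rangeI)
  then show False
    using m below a b by (metis less_asym linorder_neqE strict_mono_less)
qed

text \<open>By counting: \<open>range\<close> is injective on increasing sequences, and there are as
  many of these as subsets of the right size.\<close>

lemma ex_strict_mono_range:
  assumes "card B = CARD('k)"
  shows "\<exists>\<beta> :: 'k::{finite,linorder} \<Rightarrow> 'n::{finite,linorder}. strict_mono \<beta> \<and> range \<beta> = B"
proof -
  let ?S = "{a :: 'k \<Rightarrow> 'n. strict_mono a}" and ?P = "{B :: 'n set. B \<subseteq> UNIV \<and> card B = CARD('k)}"
  have "inj_on range ?S" by (auto intro!: inj_onI strict_mono_range_eq_imp_eq)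
  then have "card (range ` ?S) = card ?P"
    by (simp only: card_image card_strict_mono n_subsets[OF finite])
  moreover have "range ` ?S \<subseteq> ?P"
    by (auto simp: card_image strict_mono_imp_inj_on)
  ultimately have "range ` ?S = ?P" by (intro card_subset_eq) auto
  then show ?thesis using assms by (smt (verit) imageE mem_Collect_eq subset_UNIV)
qed

text \<open>The Cauchy--Binet formula for a left factor that merely selects rows.\<close>

lemma det_select_rows:
  fixes M :: "real^('k::{finite,linorder})^('n::{finite,linorder})" and \<gamma> :: "'k \<Rightarrow> 'n"
  assumes card_r: "CARD('r::{finite,linorder}) = CARD('n) choose CARD('k)"
  shows "det (\<chi> p. M $ \<gamma> p) =
    (\<Sum>j\<in>(UNIV :: 'r set). det (\<chi> p q. (mat 1 :: real^('n::_)^('n::_)) $ \<gamma> p $ lex_seq j q) * det (\<chi> p. M $ lex_seq j p))"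
proof (cases "inj \<gamma>")
  case False
  \<comment> \<open>A repeated index gives two equal rows, both in the minor of \<open>M\<close> and
    in every coefficient taken from the identity, so both sides vanish.\<close>
  then obtain p p' where p: "p \<noteq> p'" "\<gamma> p = \<gamma> p'" by (auto simp: inj_on_def)
  then have "det (\<chi> p. V $ \<gamma> p) = 0" for V :: "real^('k::_)^('n::_)"
    by (intro det_identical_rows[OF p(1)]) (simp add: row_def)
  from this[of M] this[of "\<chi> i q. mat 1 $ i $ lex_seq (j :: 'r) q" for j] show ?thesis by simp
next
  case True
  note bij = lex_seq_bij[where 'r = 'r and 'k = 'k and 'n = 'n, OF card_r]
  have "card (range \<gamma>) = CARD('k)" using True by (simp add: card_image)
  from ex_strict_mono_range[OF this] obtain \<beta> :: "'k \<Rightarrow> 'n"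
    where \<beta>: "strict_mono \<beta>" "range \<beta> = range \<gamma>" by blast
  have inj_\<beta>: "inj \<beta>" using \<beta> by (simp add: strict_mono_imp_inj_on)
  from \<beta>(1) obtain j0 :: 'r where j0: "lex_seq j0 = \<beta>"
    using bij unfolding bij_betw_def by (metis (mono_tags, lifting) imageE mem_Collect_eq)
  \<comment> \<open>Sorting: \<open>\<gamma>\<close> is its increasing rearrangement
    \<open>\<beta>\<close> preceded by a permutation \<open>\<pi>\<close>, so all determinants
    change by the same sign.\<close>
  define \<pi> where "\<pi> = inv \<beta> \<circ> \<gamma>"
  have \<gamma>: "\<gamma> p = \<beta> (\<pi> p)" for p
    using \<beta>(2) by (simp add: \<pi>_def) (metis f_inv_into_f rangeI)
  have "inj \<pi>" using True by (metis \<gamma> injD injI)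
  then have perm: "\<pi> permutes UNIV" by (intro bij_imp_permutes) (auto simp: bij_betw_def finite_UNIV_inj_surj)
  have permute: "det (\<chi> p. V $ \<gamma> p) = of_int (sign \<pi>) * det (\<chi> p. V $ \<beta> p)" for V :: "real^('k::_)^('n::_)"
    using det_permute_rows[OF perm, of "\<chi> p. V $ \<beta> p"] by (simp add: \<gamma>)
  \<comment> \<open>Distinct increasing sequences have distinct ranges of equal size, so some row of
    the identity minor selects an index outside its columns and is zero.\<close>
  have unit: "det (\<chi> p q. (mat 1 :: real^('n::_)^('n::_)) $ \<beta> p $ lex_seq j q) = (if j = j0 then 1 else 0)" for j :: 'r
  proof (cases "j = j0")
    case True
    have "(\<chi> p q. (mat 1 :: real^('n::_)^('n::_)) $ \<beta> p $ lex_seq j q) = (mat 1 :: real^('k::_)^('k::_))"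
      using inj_\<beta> by (auto simp: True j0 mat_def vec_eq_iff inj_eq)
    then show ?thesis using True by simp
  next
    case False
    let ?\<beta>' = "lex_seq j :: 'k \<Rightarrow> 'n"
    have \<beta>': "strict_mono ?\<beta>'" using bij by (auto simp: bij_betw_def)
    have "?\<beta>' \<noteq> \<beta>" using False bij j0 by (metis UNIV_I bij_betw_def inj_onD)
    then have "range \<beta> \<noteq> range ?\<beta>'" using strict_mono_range_eq_imp_eq \<beta>(1) \<beta>' by metis
    moreover have "card (range \<beta>) = card (range ?\<beta>')"
      using inj_\<beta> \<beta>' by (simp add: card_image strict_mono_imp_inj_on)
    ultimately have "\<not> range \<beta> \<subseteq> range ?\<beta>'" by (metis card_subset_eq finite)
    then obtain p where p: "\<beta> p \<notin> range ?\<beta>'" by auto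
    have "det (\<chi> p q. (mat 1 :: real^('n::_)^('n::_)) $ \<beta> p $ ?\<beta>' q) = 0"
      by (rule det_zero_row(1)[of p]) (use p in \<open>auto simp: row_def mat_def vec_eq_iff\<close>)
    then show ?thesis using False by simp
  qed
  have coeff: "det (\<chi> p q. (mat 1 :: real^('n::_)^('n::_)) $ \<gamma> p $ lex_seq j q) =
      of_int (sign \<pi>) * (if j = j0 then 1 else 0)" for j :: 'r
    using permute[of "\<chi> i q. mat 1 $ i $ lex_seq j q"] by (simp add: unit)
  show ?thesis
    by (simp only: permute[of M] coeff) (simp add: j0 if_distrib if_distribR cong: if_cong)
qed

section \<open>Additive compounds and the differential equation for minors\<close>

text \<open>Each minor of \<open>mat 1 + \<epsilon> *\<^sub>R M\<close> is differentiated row by row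
  at \<open>0\<close>, where the other rows are those of the identity. This also shows that the
  \<open>vector_derivative\<close> in the definition is a genuine derivative.\<close>

lemma additive_compound_nth:
  fixes M :: "real^('n::{finite,linorder})^('n::_)"
  shows "(additive_compound TYPE('k::{finite,linorder}) M :: real^('r::{finite,linorder})^('r::_)) $ i $ j =
    (\<Sum>p\<in>UNIV. det (\<chi> p'. if p' = p then (\<chi> q. M $ lex_seq i p $ lex_seq j q)
                         else (\<chi> q. (mat 1 :: real^('n::_)^('n::_)) $ lex_seq i p' $ lex_seq j q) :: real^('k::_)^('k::_)))"
proof -
  define D :: "real^('r::_)^('r::_)" where "D = (\<chi> i j.
    (\<Sum>p\<in>UNIV. det (\<chi> p'. if p' = p then (\<chi> q. M $ lex_seq i p $ lex_seq j q)
                         else (\<chi> q. (mat 1 :: real^('n::_)^('n::_)) $ lex_seq i p' $ lex_seq j q) :: real^('k::_)^('k::_))))"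
  have "((\<lambda>\<epsilon>. compound TYPE('k) (mat 1 + \<epsilon> *\<^sub>R M) :: real^('r::_)^('r::_)) has_vector_derivative D) (at 0)"
  proof (intro has_vector_derivative_vecI)
    fix i j :: 'r
    let ?F = "\<lambda>\<epsilon>. \<chi> p q. (mat 1 + \<epsilon> *\<^sub>R M) $ lex_seq i p $ lex_seq j q :: real^('k::_)^('k::_)"
    let ?F' = "\<chi> p q. M $ lex_seq i p $ lex_seq j q :: real^('k::_)^('k::_)"
    have "(?F has_vector_derivative ?F') (at 0)"
      by (intro has_vector_derivative_vecI)
        (auto intro!: derivative_eq_intros simp: has_real_derivative_iff_has_vector_derivative[symmetric])
    from has_vector_derivative_det[OF this]
    show "((\<lambda>\<epsilon>. (compound TYPE('k) (mat 1 + \<epsilon> *\<^sub>R M) :: real^('r::_)^('r::_)) $ i $ j)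
        has_vector_derivative D $ i $ j) (at 0)"
      by (simp add: compound_def D_def cong: if_cong)
  qed
  then have "additive_compound TYPE('k) M = D"
    unfolding additive_compound_def by (rule vector_derivative_at)
  then show ?thesis by (simp add: D_def)
qed

text \<open>Makes the single column of the compound of an \<open>n \<times> k\<close> matrix
  explicit: the identity is the only increasing self-map of a finite chain.\<close>

lemma lex_seq_full: "(lex_seq (1::1) :: 'k::{finite,linorder} \<Rightarrow> 'k) = id"
proof -
  have "strict_mono (lex_seq (1::1) :: 'k \<Rightarrow> 'k)"
    using lex_seq_bij[where 'r = 1 and 'k = 'k and 'n = 'k] by (auto simp: bij_betw_def)
  moreover have "surj (lex_seq (1::1) :: 'k \<Rightarrow> 'k)"
    using calculation by (simp add: finite_UNIV_inj_surj strict_mono_imp_inj_on)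
  ultimately show ?thesis
    by (intro strict_mono_range_eq_imp_eq) (auto simp: strict_mono_def)
qed

lemma column_compound_nth:
  fixes W :: "real^('k::{finite,linorder})^('n::{finite,linorder})"
  shows "column 1 (compound TYPE('k) W :: real^1^('r::{finite,linorder})) $ i =
    det (\<chi> p. W $ lex_seq i p)"
  by (simp add: column_def compound_def lex_seq_full)

text \<open>After differentiation by rows, \<open>det_row_matrix_mult\<close> expands the row of
  \<open>A ** W t\<close>, and \<open>det_select_rows\<close> rewrites the resulting minors in terms
  of those with increasing rows. The collected coefficients are the entries of the additive
  compound.\<close>

lemma column_compound_has_vector_derivative:
  fixes W :: "real \<Rightarrow> real^('k::{finite,linorder})^('n::{finite,linorder})"
    and A :: "real^('n::_)^('n::_)"
  assumes card_r: "CARD('r::{finite,linorder}) = CARD('n) choose CARD('k)"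
    and W: "(W has_vector_derivative A ** W t) (at t within S)"
  shows "((\<lambda>t. column 1 (compound TYPE('k) (W t) :: real^1^('r::_))) has_vector_derivative
    additive_compound TYPE('k) A *v column 1 (compound TYPE('k) (W t) :: real^1^('r::_))) (at t within S)"
proof (rule has_vector_derivative_vecI)
  fix i :: 'r
  let ?y = "\<lambda>t. column 1 (compound TYPE('k) (W t) :: real^1^('r::_))"
  let ?\<alpha> = "lex_seq i :: 'k \<Rightarrow> 'n"
  \<comment> \<open>The identity restricted to the columns in \<open>lex_seq j\<close>. Since
    \<open>A ** ?E j\<close> selects these columns of \<open>A\<close>, the row expansion used for
    \<open>W t\<close> also expands entry \<open>(i, j)\<close> of the additive compound.\<close>
  let ?E = "\<lambda>j. \<chi> l q. mat 1 $ l $ lex_seq (j :: 'r) q :: real^('k::_)^('n::_)"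
  have "A ** ?E j = (\<chi> l q. A $ l $ lex_seq j q)" for j
    by (simp add: vec_eq_iff matrix_matrix_mult_def mat_def if_distrib cong: if_cong)
  then have E: "det (\<chi> p'. if p' = p then (\<chi> q. A $ ?\<alpha> p $ lex_seq j q)
                         else (\<chi> q. (mat 1 :: real^('n::_)^('n::_)) $ ?\<alpha> p' $ lex_seq j q) :: real^('k::_)^('k::_))
      = (\<Sum>l\<in>UNIV. A $ ?\<alpha> p $ l * det (\<chi> p'. ?E j $ (?\<alpha>(p := l)) p'))" for p j
    using det_row_matrix_mult[of p A "?E j" "?\<alpha> p" ?\<alpha>] by (simp cong: if_cong)
  have "((\<lambda>t. \<chi> p. W t $ ?\<alpha> p) has_vector_derivative (\<chi> p. (A ** W t) $ ?\<alpha> p)) (at t within S)"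
    by (rule has_vector_derivative_vecI) (simp add: has_vector_derivative_vec_nth[OF W])
  from has_vector_derivative_det[OF this]
  have deriv: "((\<lambda>t. ?y t $ i) has_vector_derivative
      (\<Sum>p\<in>UNIV. det (\<chi> p'. if p' = p then (A ** W t) $ ?\<alpha> p' else W t $ ?\<alpha> p'))) (at t within S)"
    by (simp add: column_compound_nth cong: if_cong)
  have "(\<Sum>p\<in>UNIV. det (\<chi> p'. if p' = p then (A ** W t) $ ?\<alpha> p' else W t $ ?\<alpha> p'))
      = (\<Sum>p\<in>UNIV. \<Sum>l\<in>UNIV. A $ ?\<alpha> p $ l * det (\<chi> p'. W t $ (?\<alpha>(p := l)) p'))"
    by (subst det_row_matrix_mult[symmetric], intro sum.cong arg_cong[where f = det])
      (auto simp: vec_eq_iff)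
  also have "\<dots> = (\<Sum>p\<in>UNIV. \<Sum>l\<in>UNIV. \<Sum>j\<in>UNIV.
      A $ ?\<alpha> p $ l * (det (\<chi> p'. ?E j $ (?\<alpha>(p := l)) p') * ?y t $ j))"
    by (subst det_select_rows[OF card_r]) (simp add: sum_distrib_left column_compound_nth)
  also have "\<dots> = (\<Sum>j\<in>UNIV. \<Sum>p\<in>UNIV. \<Sum>l\<in>UNIV.
      A $ ?\<alpha> p $ l * (det (\<chi> p'. ?E j $ (?\<alpha>(p := l)) p') * ?y t $ j))"
    by (subst sum.swap[where A = "UNIV :: 'n set" and B = "UNIV :: 'r set"]) (rule sum.swap)
  also have "\<dots> = (additive_compound TYPE('k) A *v ?y t) $ i"
    by (simp only: matrix_vector_mult_def vec_lambda_beta additive_compound_nth E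
      sum_distrib_right mult.assoc)
  finally show "((\<lambda>t. ?y t $ i) has_vector_derivative (additive_compound TYPE('k) A *v ?y t) $ i)
      (at t within S)" using deriv by (simp only:)
qed

subsection \<open>Vector norms and matrix measures\<close>

lemma vector_norm_zero: "is_vector_norm N \<Longrightarrow> N 0 = 0"
  and vector_norm_nonneg: "is_vector_norm N \<Longrightarrow> 0 \<le> N x"
  and vector_norm_eq_0: "is_vector_norm N \<Longrightarrow> N x = 0 \<longleftrightarrow> x = 0"
  and vector_norm_scaleR: "is_vector_norm N \<Longrightarrow> N (c *\<^sub>R x) = \<bar>c\<bar> * N x"
  and vector_norm_triangle: "is_vector_norm N \<Longrightarrow> N (x + y) \<le> N x + N y"
  by (auto simp: is_vector_norm_def)

lemma vector_norm_sum:
  assumes "is_vector_norm N"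
  shows "N (\<Sum>i\<in>I. g i) \<le> (\<Sum>i\<in>I. N (g i))"
proof (induction I rule: infinite_finite_induct)
  case (insert i I)
  then show ?case using vector_norm_triangle[OF assms, of "g i" "sum g I"] by simp
qed (simp_all add: vector_norm_zero[OF assms])

lemma vector_norm_le_norm:
  fixes N :: "'a::euclidean_space \<Rightarrow> real"
  assumes N: "is_vector_norm N"
  obtains C where "0 < C" "\<And>x. N x \<le> C * norm x"
proof
  let ?C = "(\<Sum>b\<in>Basis. N b) + 1"
  have nn: "0 \<le> (\<Sum>b\<in>Basis. N b)" by (intro sum_nonneg vector_norm_nonneg[OF N])
  then show "0 < ?C" by simp
  fix x :: 'a
  have "N x = N (\<Sum>b\<in>Basis. (x \<bullet> b) *\<^sub>R b)" by (simp add: euclidean_representation)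
  also have "\<dots> \<le> (\<Sum>b\<in>Basis. \<bar>x \<bullet> b\<bar> * N b)"
    using vector_norm_sum[OF N, of "\<lambda>b. (x \<bullet> b) *\<^sub>R b" Basis] by (simp add: vector_norm_scaleR[OF N])
  also have "\<dots> \<le> (\<Sum>b\<in>Basis. norm x * N b)"
    by (intro sum_mono mult_right_mono Basis_le_norm vector_norm_nonneg[OF N])
  also have "\<dots> = norm x * (\<Sum>b\<in>Basis. N b)" by (simp add: sum_distrib_left)
  also have "\<dots> \<le> ?C * norm x" by (simp add: distrib_right)
  finally show "N x \<le> ?C * norm x" .
qed

lemma vector_norm_continuous:
  fixes N :: "'a::euclidean_space \<Rightarrow> real"
  assumes N: "is_vector_norm N"
  shows "continuous_on S N"
proof -
  obtain C where C: "0 < C" "\<And>x. N x \<le> C * norm x" using vector_norm_le_norm[OF N] by blast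
  have "\<bar>N x - N y\<bar> \<le> C * dist x y" for x y
    using vector_norm_triangle[OF N, of "x - y" y] vector_norm_triangle[OF N, of "y - x" x]
      C(2)[of "x - y"] C(2)[of "y - x"] by (simp add: dist_norm norm_minus_commute)
  then have "C-lipschitz_on S N"
    using C(1) by (intro lipschitz_onI) (auto simp: dist_real_def)
  then show ?thesis by (rule lipschitz_on_continuous_on)
qed

text \<open>The continuous \<open>N\<close> attains a positive minimum on the compact Euclidean unit
  sphere; homogeneity extends the bound to all vectors.\<close>

lemma norm_le_vector_norm:
  fixes N :: "'a::euclidean_space \<Rightarrow> real"
  assumes N: "is_vector_norm N"
  obtains c where "0 < c" "\<And>x. norm x \<le> c * N x"
proof -
  have "sphere (0::'a) 1 \<noteq> {}" using norm_Basis SOME_Basis by (metis mem_sphere_0 empty_iff)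
  then obtain z where z: "z \<in> sphere 0 1" "\<And>x. x \<in> sphere 0 1 \<Longrightarrow> N z \<le> N x"
    using continuous_attains_inf[OF compact_sphere _ vector_norm_continuous[OF N]] by blast
  have "z \<noteq> 0" using z by auto
  then have pos: "0 < N z" using vector_norm_eq_0[OF N] vector_norm_nonneg[OF N] by (metis less_le)
  have "norm x \<le> (1 / N z) * N x" for x
  proof (cases "x = 0")
    case False
    then have "N z \<le> N ((1 / norm x) *\<^sub>R x)" by (intro z(2)) simp
    then show ?thesis using False pos by (simp add: vector_norm_scaleR[OF N] field_simps)
  qed (simp add: vector_norm_nonneg[OF N] vector_norm_zero[OF N])
  then show thesis using pos that[of "1 / N z"] by simp
qed

section \<open>Induced norms and the limit defining the matrix measure\<close>

context
  fixes N :: "real^'r \<Rightarrow> real"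
  assumes N: "is_vector_norm N"
begin

lemma vector_norm_unit_exists: "\<exists>x. N x = 1"
proof -
  obtain b :: "real^'r" where "b \<noteq> 0" using nonzero_Basis SOME_Basis by blast
  then have "N ((1 / N b) *\<^sub>R b) = 1"
    using vector_norm_eq_0[OF N] vector_norm_nonneg[OF N, of b] by (simp add: vector_norm_scaleR[OF N])
  then show ?thesis by blast
qed

text \<open>Ensures that the \<open>SUP\<close> in \<open>induced_norm\<close> is a genuine
  supremum. The bound comes from \<open>onorm\<close> and the equivalence of \<open>N\<close> with
  the Euclidean norm.\<close>

lemma bdd_above_vector_norm_image: "bdd_above ((\<lambda>x. N (A *v x)) ` {x. N x = 1})"
proof -
  obtain C where C: "0 < C" "\<And>x. N x \<le> C * norm x" using vector_norm_le_norm[OF N] by blast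
  obtain c where c: "0 < c" "\<And>x. norm x \<le> c * N x" using norm_le_vector_norm[OF N] by blast
  have "N (A *v x) \<le> C * (onorm ((*v) A) * c)" if "N x = 1" for x
  proof -
    have "N (A *v x) \<le> C * norm (A *v x)" by (rule C)
    also have "\<dots> \<le> C * (onorm ((*v) A) * norm x)"
      using C(1) by (intro mult_left_mono onorm) auto
    also have "\<dots> \<le> C * (onorm ((*v) A) * c)"
      using C(1) c(2)[of x] that by (intro mult_left_mono onorm_pos_le) auto
    finally show ?thesis .
  qed
  then show ?thesis by (auto intro!: bdd_aboveI)
qed

lemma vector_norm_le_induced_norm: "N (A *v x) \<le> induced_norm N A * N x"
proof (cases "x = 0")
  case False
  then have pos: "0 < N x" using vector_norm_eq_0[OF N] vector_norm_nonneg[OF N] by (metis less_le)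
  then have "N ((1 / N x) *\<^sub>R x) = 1" by (simp add: vector_norm_scaleR[OF N])
  then have "N (A *v ((1 / N x) *\<^sub>R x)) \<le> induced_norm N A"
    unfolding induced_norm_def by (intro cSUP_upper bdd_above_vector_norm_image) simp
  then show ?thesis
    using pos by (simp add: matrix_vector_mult_scaleR vector_norm_scaleR[OF N] field_simps)
qed (simp add: vector_norm_zero[OF N])

lemma induced_norm_leI: "(\<And>x. N x = 1 \<Longrightarrow> N (A *v x) \<le> c) \<Longrightarrow> induced_norm N A \<le> c"
  unfolding induced_norm_def using vector_norm_unit_exists by (intro cSUP_least) auto

text \<open>Convexity of the induced norm makes the difference quotient monotone, so that the limit exists and
  \<open>Lim\<close> is not a junk value.\<close>

lemma matrix_measure_tendsto:
  "((\<lambda>\<epsilon>. (induced_norm N (mat 1 + \<epsilon> *\<^sub>R A) - 1) / \<epsilon>) \<longlongrightarrow> matrix_measure N A) (at_right 0)"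
proof -
  let ?q = "\<lambda>\<epsilon>. (induced_norm N (mat 1 + \<epsilon> *\<^sub>R A) - 1) / \<epsilon>"
  have mv: "(mat 1 + \<epsilon> *\<^sub>R A) *v x = x + \<epsilon> *\<^sub>R (A *v x)" for \<epsilon> x
    by (simp add: matrix_vector_mult_add_rdistrib scaleR_matrix_vector_assoc)
  obtain x0 where x0: "N x0 = 1" using vector_norm_unit_exists by blast
  have "?q a \<le> ?q b" if "0 < a" "a \<le> b" for a b
  proof -
    have "induced_norm N (mat 1 + a *\<^sub>R A) \<le> 1 + a / b * (induced_norm N (mat 1 + b *\<^sub>R A) - 1)"
    proof (rule induced_norm_leI)
      fix x assume x: "N x = 1"
      \<comment> \<open>\<open>mat 1 + a *\<^sub>R A\<close> is the convex combination of
        \<open>mat 1\<close> and \<open>mat 1 + b *\<^sub>R A\<close> with weight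
        \<open>a / b\<close> on the latter.\<close>
      have "(mat 1 + a *\<^sub>R A) *v x = (1 - a / b) *\<^sub>R x + (a / b) *\<^sub>R ((mat 1 + b *\<^sub>R A) *v x)"
        using that by (simp add: mv scaleR_matrix_vector_assoc algebra_simps)
      then have "N ((mat 1 + a *\<^sub>R A) *v x)
          \<le> (1 - a / b) * N x + a / b * N ((mat 1 + b *\<^sub>R A) *v x)"
        using vector_norm_triangle[OF N, of "(1 - a / b) *\<^sub>R x" "(a / b) *\<^sub>R ((mat 1 + b *\<^sub>R A) *v x)"] that
        by (simp add: vector_norm_scaleR[OF N])
      also have "\<dots> \<le> (1 - a / b) * 1 + a / b * (induced_norm N (mat 1 + b *\<^sub>R A) * 1)"
        using that x vector_norm_le_induced_norm[of "mat 1 + b *\<^sub>R A" x]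
        by (intro add_mono mult_left_mono) auto
      finally show "N ((mat 1 + a *\<^sub>R A) *v x) \<le> 1 + a / b * (induced_norm N (mat 1 + b *\<^sub>R A) - 1)"
        by (simp add: algebra_simps)
    qed
    then show ?thesis using that by (simp add: field_simps)
  qed
  \<comment> \<open>The triangle inequality at a unit vector bounds the quotients below, so their
    infimum is finite and, by monotonicity, is the limit from the right.\<close>
  moreover have "- N (A *v x0) \<le> ?q a" if "0 < a" for a
  proof -
    have "N x0 \<le> N ((mat 1 + a *\<^sub>R A) *v x0) + N ((- a) *\<^sub>R (A *v x0))"
      using vector_norm_triangle[OF N, of "(mat 1 + a *\<^sub>R A) *v x0" "(- a) *\<^sub>R (A *v x0)"]
      by (simp add: mv)
    also have "N ((mat 1 + a *\<^sub>R A) *v x0) \<le> induced_norm N (mat 1 + a *\<^sub>R A) * N x0"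
      by (rule vector_norm_le_induced_norm)
    finally have "1 \<le> induced_norm N (mat 1 + a *\<^sub>R A) + a * N (A *v x0)"
      using that x0 vector_norm_scaleR[OF N, of "- a"] by simp
    then show ?thesis using that by (simp add: field_simps)
  qed
  ultimately have "(?q \<longlongrightarrow> Inf (?q ` ({0<..} \<inter> UNIV))) (at 0 within ({0<..} \<inter> UNIV))"
    by (intro Lim_right_bound) auto
  then have "(?q \<longlongrightarrow> Inf (?q ` {0<..})) (at_right 0)" by simp
  moreover from this have "matrix_measure N A = Inf (?q ` {0<..})"
    unfolding matrix_measure_def by (intro tendsto_Lim) auto
  ultimately show ?thesis by simp
qed

text \<open>Up to an error of order less than \<open>s - t\<close>, the vector \<open>y s\<close> is
  \<open>mat 1 + (s - t) *\<^sub>R A\<close> applied to \<open>y t\<close>. The limit defining the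
  measure bounds the induced norm of that matrix by
  \<open>1 + (s - t) * (k + \<delta>)\<close>.\<close>

lemma vector_norm_dini:
  assumes y: "(y has_vector_derivative A *v y t) (at_right t)"
    and "matrix_measure N A \<le> k" "0 < \<epsilon>"
  shows "\<forall>\<^sub>F s in at_right t. N (y s) \<le> N (y t) + (s - t) * (k * N (y t) + \<epsilon>)"
proof -
  obtain C where C: "0 < C" "\<And>x. N x \<le> C * norm x" using vector_norm_le_norm[OF N] by blast
  \<comment> \<open>One half of \<open>\<epsilon>\<close> pays for the error in the measure, the
    other for the remainder of \<open>y\<close>. The summand \<open>1\<close> avoids division by
    zero when \<open>y t = 0\<close>.\<close>
  define \<delta> where "\<delta> = \<epsilon> / (2 * (N (y t) + 1))"
  have ny: "0 \<le> N (y t)" by (rule vector_norm_nonneg[OF N])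
  have \<delta>: "0 < \<delta>" "\<delta> * N (y t) \<le> \<epsilon> / 2"
    using \<open>0 < \<epsilon>\<close> ny by (auto simp: \<delta>_def field_simps)
  have sub: "((\<lambda>s. s - t) \<longlongrightarrow> 0) (at_right t)"
    by (auto intro!: tendsto_eq_intros)
  have pos: "\<forall>\<^sub>F s in at_right t. 0 < s - t"
    using eventually_at_right_less[of t] by simp
  then have "filterlim (\<lambda>s. s - t) (at_right 0) (at_right t)"
    using sub by (auto simp: filterlim_at elim: eventually_mono)
  from filterlim_compose[OF matrix_measure_tendsto[of A] this]
  have "\<forall>\<^sub>F s in at_right t. (induced_norm N (mat 1 + (s - t) *\<^sub>R A) - 1) / (s - t) < k + \<delta>"
    by (rule order_tendstoD) (use assms(2) \<delta> in simp)
  moreover have "((\<lambda>s. (1 / norm (s - t)) *\<^sub>R (y s - (y t + (s - t) *\<^sub>R (A *v y t)))) \<longlongrightarrow> 0) (at_right t)"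
    using y by (simp add: has_vector_derivative_def has_derivative_within)
  from order_tendstoD(2)[OF tendsto_norm_zero[OF this], of "\<epsilon> / (2 * C)"]
  have "\<forall>\<^sub>F s in at_right t.
      norm ((1 / norm (s - t)) *\<^sub>R (y s - (y t + (s - t) *\<^sub>R (A *v y t)))) < \<epsilon> / (2 * C)"
    using C \<open>0 < \<epsilon>\<close> by simp
  ultimately show ?thesis using pos
  proof eventually_elim
    case (elim s)
    let ?h = "s - t" and ?r = "y s - (y t + (s - t) *\<^sub>R (A *v y t))"
    have "y s = (mat 1 + ?h *\<^sub>R A) *v y t + ?r"
      by (simp add: matrix_vector_mult_add_rdistrib scaleR_matrix_vector_assoc)
    then have "N (y s) \<le> N ((mat 1 + ?h *\<^sub>R A) *v y t) + N ?r"
      using vector_norm_triangle[OF N] by metis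
    also have "N ((mat 1 + ?h *\<^sub>R A) *v y t) \<le> induced_norm N (mat 1 + ?h *\<^sub>R A) * N (y t)"
      by (rule vector_norm_le_induced_norm)
    also have "\<dots> \<le> (1 + ?h * (k + \<delta>)) * N (y t)"
      using elim ny by (intro mult_right_mono) (auto simp: field_simps)
    also have "N ?r \<le> ?h * (\<epsilon> / 2)"
    proof -
      have "norm ?r = ?h * norm ((1 / norm ?h) *\<^sub>R ?r)" using elim by simp
      also have "\<dots> \<le> ?h * (\<epsilon> / (2 * C))" using elim by (intro mult_left_mono) auto
      finally have "norm ?r \<le> ?h * (\<epsilon> / (2 * C))" .
      then have "C * norm ?r \<le> C * (?h * (\<epsilon> / (2 * C)))" using C by (intro mult_left_mono) auto
      also have "\<dots> = ?h * (\<epsilon> / 2)" using C(1) by simp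
      finally show ?thesis using C(2)[of ?r] by linarith
    qed
    also have "(1 + ?h * (k + \<delta>)) * N (y t) + ?h * (\<epsilon> / 2)
        = N (y t) + ?h * (k * N (y t) + (\<delta> * N (y t) + \<epsilon> / 2))" by (simp add: algebra_simps)
    also have "\<dots> \<le> N (y t) + ?h * (k * N (y t) + \<epsilon>)"
      using elim \<delta> by (intro add_left_mono mult_left_mono) auto
    finally show ?case by simp
  qed
qed

end

subsection \<open>Dependence on initial values\<close>

lemma bounded_bilinear_matrix_vector_mult:
  "bounded_bilinear ((*v) :: real^'n^'m \<Rightarrow> real^'n \<Rightarrow> real^'m)"
  unfolding bilinear_conv_bounded_bilinear[symmetric] bilinear_def
  by (auto intro!: linearI simp: matrix_vector_mult_add_rdistrib matrix_vector_right_distrib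
      scaleR_matrix_vector_assoc matrix_vector_mult_scaleR)

lemma bounded_bilinear_matrix_matrix_mult:
  "bounded_bilinear ((**) :: real^'n^'m \<Rightarrow> real^'p^'n \<Rightarrow> real^'p^'m)"
  unfolding bilinear_conv_bounded_bilinear[symmetric] bilinear_def
  by (auto intro!: linearI simp: vec_eq_iff matrix_matrix_mult_def sum_distrib_left
      algebra_simps sum.distrib)

text \<open>Converts a bound on the derivative of \<open>g\<close> into the form of the Dini
  hypothesis of \<open>dini_gronwall\<close>; \<open>\<epsilon>\<close> absorbs the remainder of the
  linear approximation.\<close>

lemma norm_dini:
  fixes g :: "real \<Rightarrow> 'a::real_normed_vector"
  assumes g: "(g has_vector_derivative g') (at_right t)" and "0 < \<epsilon>"
  shows "\<forall>\<^sub>F s in at_right t. norm (g s) \<le> norm (g t) + (s - t) * (norm g' + \<epsilon>)"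
proof -
  have "((\<lambda>s. (1 / norm (s - t)) *\<^sub>R (g s - (g t + (s - t) *\<^sub>R g'))) \<longlongrightarrow> 0) (at_right t)"
    using g by (simp add: has_vector_derivative_def has_derivative_within)
  from order_tendstoD(2)[OF tendsto_norm_zero[OF this] \<open>0 < \<epsilon>\<close>]
  have "\<forall>\<^sub>F s in at_right t. norm ((1 / norm (s - t)) *\<^sub>R (g s - (g t + (s - t) *\<^sub>R g'))) < \<epsilon>" .
  then show ?thesis using eventually_at_right_less[of t]
  proof eventually_elim
    case (elim s)
    let ?r = "g s - (g t + (s - t) *\<^sub>R g')"
    have "norm ?r = (s - t) * norm ((1 / norm (s - t)) *\<^sub>R ?r)" using elim by simp
    also have "\<dots> \<le> (s - t) * \<epsilon>" using elim by (intro mult_left_mono) auto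
    finally have "norm ?r \<le> (s - t) * \<epsilon>" .
    moreover have "norm (g s) \<le> norm (g t) + norm ((s - t) *\<^sub>R g') + norm ?r"
      using norm_triangle_ineq[of "g t + (s - t) *\<^sub>R g'" ?r] norm_triangle_ineq[of "g t" "(s - t) *\<^sub>R g'"]
      by simp
    moreover have "norm ((s - t) *\<^sub>R g') = (s - t) * norm g'" using elim by simp
    ultimately show ?case unfolding distrib_left by linarith
  qed
qed

lemma at_right_le_at_within:
  fixes t :: real
  assumes "0 \<le> t" "t < T"
  shows "at_right t \<le> at t within {0..T}"
  unfolding at_within_Icc_at_right[OF \<open>t < T\<close>, symmetric] using assms by (intro at_le) auto

lemma has_vector_derivative_at_right:
  assumes "(g has_vector_derivative g') (at t within {0..T})" "0 \<le> t" "t < T"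
  shows "(g has_vector_derivative g') (at_right t)"
  using assms at_right_le_at_within[OF assms(2,3)]
  unfolding has_vector_derivative_def has_derivative_within by (auto intro: tendsto_mono)

text \<open>Only differences of solutions are estimated, since \<open>f\<close> may be discontinuous in time and no
  solutions need exist for initial values outside \<open>\<Omega>\<close>.\<close>

lemma has_derivative_initial_value:
  fixes f :: "real \<Rightarrow> real^'n \<Rightarrow> real^'n" and J :: "real \<Rightarrow> real^'n \<Rightarrow> real^'n^'n"
  assumes J: "\<And>t x. 0 \<le> t \<Longrightarrow> (f t has_derivative (*v) (J t x)) (at x)"
    and J_cont: "continuous_on ({0..} \<times> UNIV) (\<lambda>(t, x). J t x)"
    and sol: "\<And>b. b \<in> \<Omega> \<Longrightarrow> solves f b (\<phi> b)"
    and a: "a \<in> \<Omega>" and "0 \<le> T"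
    and \<Phi>_0: "\<Phi> 0 = mat 1"
    and \<Phi>': "\<And>t. t \<in> {0..T} \<Longrightarrow> (\<Phi> has_vector_derivative J t (\<phi> a t) ** \<Phi> t) (at t within {0..T})"
    and t: "t \<in> {0..T}"
  shows "((\<lambda>b. \<phi> b t) has_derivative (*v) (\<Phi> t)) (at a within \<Omega>)"
proof -
  interpret mv: bounded_bilinear "(*v) :: real^'n^'n \<Rightarrow> real^'n \<Rightarrow> real^'n"
    by (rule bounded_bilinear_matrix_vector_mult)
  obtain K where K: "0 < K" "\<And>(A :: real^'n^'n) v. norm (A *v v) \<le> norm A * norm v * K"
    using mv.pos_bounded by blast
  have \<phi>': "(\<phi> b has_vector_derivative f t (\<phi> b t)) (at t within {0..T})"
    if "b \<in> \<Omega>" "t \<in> {0..T}" for b t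
    using sol[OF that(1)] that(2) unfolding solves_def
    by (intro has_vector_derivative_within_subset[of _ _ _ "{0..}" "{0..T}"]) auto
  have \<phi>_0: "\<phi> b 0 = b" if "b \<in> \<Omega>" for b
    using sol[OF that] by (simp add: solves_def)
  have \<phi>_cont: "continuous_on {0..T} (\<phi> b)" if "b \<in> \<Omega>" for b
    using \<phi>'[OF that] by (rule continuous_on_vector_derivative)
  \<comment> \<open>The Jacobian in coordinates relative to the reference trajectory: a tube of
    radius \<open>1\<close> around it becomes the compact product \<open>?D\<close>, on which
    \<open>G\<close> is bounded and uniformly continuous.\<close>
  define G where "G p = J (fst p) (\<phi> a (fst p) + snd p)" for p
  let ?D = "{0..T} \<times> cball (0 :: real^'n) 1"
  have "continuous_on ?D ((\<lambda>(t, x). J t x) \<circ> (\<lambda>p. (fst p, \<phi> a (fst p) + snd p)))"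
  proof (rule continuous_on_compose)
    show "continuous_on ?D (\<lambda>p. (fst p, \<phi> a (fst p) + snd p))"
      by (intro continuous_intros continuous_on_compose2[OF \<phi>_cont[OF a]]) auto
  qed (rule continuous_on_subset[OF J_cont], auto)
  then have G_cont: "continuous_on ?D G" by (simp add: G_def[abs_def] comp_def)
  have D: "compact ?D" by (intro compact_Times) auto
  obtain M where M: "0 < M" "\<And>p. p \<in> ?D \<Longrightarrow> norm (G p) \<le> M"
    using compact_imp_bounded[OF compact_continuous_image[OF G_cont D]]
    by (force simp: bounded_pos)
  define L where "L = M * K"
  have L: "0 < L" using M K by (simp add: L_def)
  have onorm_le: "onorm ((*v) A) \<le> norm A * K" for A :: "real^'n^'n"
    by (rule onorm_le) (use K(2)[of A] in \<open>simp add: mult_ac\<close>)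
  \<comment> \<open>The mean value inequality on a ball of the tube; no global Lipschitz constant is
    available.\<close>
  have lip: "norm (f t (\<phi> a t + z) - f t (\<phi> a t)) \<le> L * norm z"
    if "t \<in> {0..T}" "norm z \<le> 1" for t z
  proof -
    have "norm (f t (\<phi> a t + z) - f t (\<phi> a t)) \<le> L * norm (\<phi> a t + z - \<phi> a t)"
    proof (rule differentiable_bound)
      show "(f t has_derivative (*v) (J t x)) (at x within cball (\<phi> a t) 1)" for x
        using J[of t x] that by (auto intro: has_derivative_at_withinI)
      show "onorm ((*v) (J t x)) \<le> L" if x: "x \<in> cball (\<phi> a t) 1" for x
      proof -
        have "norm (J t x) \<le> M"
          using M(2)[of "(t, x - \<phi> a t)"] x \<open>t \<in> {0..T}\<close>
          by (simp add: G_def dist_norm norm_minus_commute)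
        then have "norm (J t x) * K \<le> L" using K unfolding L_def by (intro mult_right_mono) auto
        then show ?thesis using onorm_le[of "J t x"] by linarith
      qed
    qed (use that in \<open>auto simp: dist_norm\<close>)
    then show ?thesis by simp
  qed
  have J_bound: "norm (J t (\<phi> a t) *v w) \<le> L * norm w" if "t \<in> {0..T}" for t w
  proof -
    have "norm (J t (\<phi> a t)) \<le> M" using M(2)[of "(t, 0)"] that by (simp add: G_def)
    then have "norm (J t (\<phi> a t)) * norm w * K \<le> M * norm w * K"
      using K by (intro mult_right_mono) auto
    then show ?thesis using K(2)[of "J t (\<phi> a t)" w] by (simp add: L_def mult_ac)
  qed
  \<comment> \<open>Uniform continuity of \<open>G\<close> makes the linearization error small
    uniformly in time.\<close>
  have linearization: "\<exists>\<delta>>0. \<forall>t\<in>{0..T}. \<forall>z. norm z \<le> \<delta> \<longrightarrow>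
      norm (f t (\<phi> a t + z) - f t (\<phi> a t) - J t (\<phi> a t) *v z) \<le> e * norm z" if "0 < e" for e
  proof -
    have "uniformly_continuous_on ?D G" using G_cont D by (rule compact_uniformly_continuous)
    then obtain d where d: "0 < d"
      "\<And>p q. p \<in> ?D \<Longrightarrow> q \<in> ?D \<Longrightarrow> dist q p < d \<Longrightarrow> dist (G q) (G p) < e / K"
      unfolding uniformly_continuous_on_def using \<open>0 < e\<close> K(1) by (metis divide_pos_pos)
    \<comment> \<open>The bound \<open>1\<close> keeps displacements in the tube, and
      \<open>d / 2\<close> keeps them strictly below \<open>d\<close>.\<close>
    define \<delta> where "\<delta> = min 1 (d / 2)"
    have \<delta>: "0 < \<delta>" "\<delta> \<le> 1" "\<delta> < d" using d(1) by (auto simp: \<delta>_def)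
    have "norm (f t (\<phi> a t + z) - f t (\<phi> a t) - J t (\<phi> a t) *v z) \<le> e * norm z"
      if t: "t \<in> {0..T}" and z: "norm z \<le> \<delta>" for t z
    proof -
      let ?S = "cball (\<phi> a t) \<delta>"
      have "norm (f t (\<phi> a t + z) - f t (\<phi> a t) - J t (\<phi> a t) *v (\<phi> a t + z - \<phi> a t))
          \<le> norm (\<phi> a t + z - \<phi> a t) * e"
      proof (rule differentiable_bound_linearization[where S = ?S and f' = "\<lambda>x. (*v) (J t x)"])
        fix \<theta> :: real assume "\<theta> \<in> {0..1}"
        then have "\<theta> * norm z \<le> 1 * \<delta>" using z by (intro mult_mono) auto
        then show "\<phi> a t + \<theta> *\<^sub>R (\<phi> a t + z - \<phi> a t) \<in> ?S" using \<open>\<theta> \<in> {0..1}\<close> by (simp add: dist_norm)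
      next
        show "(f t has_derivative (*v) (J t x)) (at x within ?S)" for x
          using J[of t x] t by (auto intro: has_derivative_at_withinI)
        fix x assume x: "x \<in> ?S"
        have "dist (G (t, x - \<phi> a t)) (G (t, 0)) < e / K"
          using x t \<delta> by (intro d(2)) (auto simp: dist_norm norm_minus_commute dist_Pair_Pair)
        then have "norm (J t x - J t (\<phi> a t)) * K \<le> e"
          using K(1) by (simp add: G_def dist_norm field_simps)
        moreover have "(*v) (J t x) - (*v) (J t (\<phi> a t)) = (*v) (J t x - J t (\<phi> a t))"
          by (simp add: fun_eq_iff mv.diff_left)
        ultimately show "onorm ((*v) (J t x) - (*v) (J t (\<phi> a t))) \<le> e"
          using onorm_le[of "J t x - J t (\<phi> a t)"] by simp
      qed (use \<delta> in auto)
      then show ?thesis by (simp add: mult.commute)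
    qed
    then show ?thesis using \<delta>(1) by blast
  qed

  define z where "z b t = \<phi> b t - \<phi> a t" for b t
  have z': "(z b has_vector_derivative f t (\<phi> a t + z b t) - f t (\<phi> a t)) (at t within {0..T})"
    if "b \<in> \<Omega>" "t \<in> {0..T}" for b t
    using has_vector_derivative_diff[OF \<phi>'[OF that] \<phi>'[OF a that(2)]] by (simp add: z_def[abs_def])
  have z_0: "z b 0 = b - a" if "b \<in> \<Omega>" for b
    using that a by (simp add: z_def \<phi>_0)
  \<comment> \<open>The estimate \<open>lip\<close> presupposes \<open>norm (z b t) \<le> 1\<close>.
    The premise on \<open>b\<close> and the margin \<open>1 / 2\<close> in
    \<open>dini_gronwall\<close> add up to exactly this bound.\<close>
  have z_le: "norm (z b t) \<le> exp (L * t) * norm (b - a)"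
    if b: "b \<in> \<Omega>" "exp (L * T) * norm (b - a) \<le> 1 / 2" and t: "t \<in> {0..T}" for b t
  proof -
    have "norm (z b t) \<le> exp (L * t) * norm (z b 0)"
    proof (rule dini_gronwall[where g = "\<lambda>t. norm (z b t)" and T = T and \<delta> = "1 / 2"])
      show "continuous_on {0..T} (\<lambda>t. norm (z b t))"
        using z'[OF b(1)] by (intro continuous_on_norm continuous_on_vector_derivative)
      fix t \<epsilon> :: real
      assume t: "0 \<le> t" "t < T" and le: "norm (z b t) \<le> exp (L * t) * norm (z b 0) + 1 / 2" and "0 < \<epsilon>"
      have "exp (L * t) * norm (b - a) \<le> exp (L * T) * norm (b - a)"
        using t L by (intro mult_right_mono) auto
      then have "norm (z b t) \<le> 1" using le b by (simp add: z_0)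
      then have "norm (f t (\<phi> a t + z b t) - f t (\<phi> a t)) \<le> L * norm (z b t)"
        using t by (intro lip) auto
      then have le': "norm (f t (\<phi> a t + z b t) - f t (\<phi> a t)) + \<epsilon> \<le> L * norm (z b t) + \<epsilon>" by simp
      have "\<forall>\<^sub>F s in at_right t. norm (z b s)
          \<le> norm (z b t) + (s - t) * (norm (f t (\<phi> a t + z b t) - f t (\<phi> a t)) + \<epsilon>)"
        using t by (intro norm_dini has_vector_derivative_at_right[OF z'[OF b(1)]] \<open>0 < \<epsilon>\<close>) auto
      then show "\<forall>\<^sub>F s in at_right t. norm (z b s) \<le> norm (z b t) + (s - t) * (L * norm (z b t) + \<epsilon>)"
        using eventually_at_right_less[of t]
      proof eventually_elim
        case (elim s)
        then show ?case
          by (elim order_trans, intro add_left_mono mult_left_mono le') auto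
      qed
    qed (use t in auto)
    then show ?thesis using b by (simp add: z_0)
  qed

  let ?E = "exp (L * T)"
  have main: "\<exists>d>0. \<forall>b\<in>\<Omega>. norm (b - a) < d \<longrightarrow> norm (\<phi> b t - \<phi> a t - \<Phi> t *v (b - a)) \<le> \<epsilon> * norm (b - a)"
    if "0 < \<epsilon>" for \<epsilon>
  proof -
    \<comment> \<open>Chosen to cancel the factor \<open>?E\<close> in the bound for
      \<open>z\<close>, and the factors \<open>?E\<close> and \<open>1 / L\<close> from the final
      comparison.\<close>
    define e where "e = \<epsilon> * L / (?E * ?E)"
    have "0 < e" using \<open>0 < \<epsilon>\<close> L by (simp add: e_def)
    from linearization[OF this] obtain \<delta> where \<delta>: "0 < \<delta>"
      "\<And>t z. t \<in> {0..T} \<Longrightarrow> norm z \<le> \<delta> \<Longrightarrow>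
        norm (f t (\<phi> a t + z) - f t (\<phi> a t) - J t (\<phi> a t) *v z) \<le> e * norm z" by blast
    define d where "d = min (1 / 2) \<delta> / ?E"
    have "norm (z b t - \<Phi> t *v (b - a)) \<le> \<epsilon> * norm (b - a)" if b: "b \<in> \<Omega>" and bd: "norm (b - a) < d" for b
    proof -
      have small: "?E * norm (b - a) \<le> 1 / 2" "?E * norm (b - a) \<le> \<delta>"
        using bd by (auto simp: d_def field_simps)
      have z_le': "norm (z b s) \<le> ?E * norm (b - a)" if "s \<in> {0..T}" for s
      proof -
        have "exp (L * s) * norm (b - a) \<le> ?E * norm (b - a)"
          using that L by (intro mult_right_mono) auto
        then show ?thesis using z_le[OF b small(1) that] by linarith
      qed
      define w where "w s = z b s - \<Phi> s *v (b - a)" for s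
      \<comment> \<open>The linearization error, which is the inhomogeneity in the equation for
        \<open>w\<close>.\<close>
      define q where "q s = f s (\<phi> a s + z b s) - f s (\<phi> a s) - J s (\<phi> a s) *v z b s" for s
      define c where "c = e * (?E * norm (b - a))"
      have w': "(w has_vector_derivative q s + J s (\<phi> a s) *v w s) (at s within {0..T})"
        if s: "s \<in> {0..T}" for s
      proof -
        have "(w has_vector_derivative (f s (\<phi> a s + z b s) - f s (\<phi> a s))
            - (J s (\<phi> a s) ** \<Phi> s) *v (b - a)) (at s within {0..T})"
          unfolding w_def[abs_def]
          by (intro has_vector_derivative_diff z' b s
            bounded_linear.has_vector_derivative[OF mv.bounded_linear_left \<Phi>'])
        then show ?thesis
          by (simp add: q_def w_def mv.diff_right matrix_vector_mul_assoc algebra_simps)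
      qed
      have q: "norm (q s) \<le> c" if "s \<in> {0..T}" for s
      proof -
        have "norm (q s) \<le> e * norm (z b s)"
          unfolding q_def using z_le'[OF that] small by (intro \<delta>(2) that) linarith
        also have "\<dots> \<le> c"
          unfolding c_def using \<open>0 < e\<close> z_le'[OF that] by (intro mult_left_mono) auto
        finally show ?thesis .
      qed
      have w_0: "w 0 = 0" using b by (simp add: w_def z_0 \<Phi>_0)
      \<comment> \<open>Adding \<open>c / L\<close> makes the comparison homogeneous: the growth
        bound \<open>L * norm (w s) + c\<close> equals
        \<open>L * (norm (w s) + c / L)\<close>.\<close>
      have "norm (w t) + c / L \<le> exp (L * t) * (norm (w 0) + c / L)"
      proof (rule dini_gronwall[where g = "\<lambda>t. norm (w t) + c / L" and T = T and \<delta> = 1])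
        show "continuous_on {0..T} (\<lambda>t. norm (w t) + c / L)"
          using w' by (intro continuous_intros continuous_on_norm continuous_on_vector_derivative)
        fix s \<epsilon> :: real assume s: "0 \<le> s" "s < T" and "0 < \<epsilon>"
        have "norm (q s + J s (\<phi> a s) *v w s) \<le> c + L * norm (w s)"
          using q[of s] J_bound[of s "w s"] s by (intro norm_triangle_mono) auto
        then have le: "norm (q s + J s (\<phi> a s) *v w s) + \<epsilon> \<le> L * (norm (w s) + c / L) + \<epsilon>"
          using L by (simp add: distrib_left)
        have "\<forall>\<^sub>F u in at_right s. norm (w u) \<le> norm (w s) + (u - s) * (norm (q s + J s (\<phi> a s) *v w s) + \<epsilon>)"
          using s by (intro norm_dini has_vector_derivative_at_right[OF w'] \<open>0 < \<epsilon>\<close>) auto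
        then show "\<forall>\<^sub>F u in at_right s. norm (w u) + c / L
            \<le> norm (w s) + c / L + (u - s) * (L * (norm (w s) + c / L) + \<epsilon>)"
          using eventually_at_right_less[of s]
        proof eventually_elim
          case (elim u)
          have "(u - s) * (norm (q s + J s (\<phi> a s) *v w s) + \<epsilon>) \<le> (u - s) * (L * (norm (w s) + c / L) + \<epsilon>)"
            using elim le by (intro mult_left_mono) auto
          then show ?case using elim by linarith
        qed
      qed (use t in auto)
      also have "\<dots> \<le> ?E * (c / L)"
        using t L \<open>0 < e\<close> unfolding w_0 norm_zero add_0
        by (intro mult_right_mono) (auto simp: c_def)
      finally have "norm (w t) \<le> ?E * (c / L)"
        using L \<open>0 < e\<close> by (smt (verit) c_def divide_nonneg_pos mult_nonneg_nonneg norm_ge_zero exp_ge_zero)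
      also have "\<dots> = \<epsilon> * norm (b - a)"
        using L by (simp add: c_def e_def)
      finally show ?thesis by (simp add: w_def)
    qed
    moreover have "0 < d" using \<delta>(1) by (simp add: d_def)
    ultimately show ?thesis unfolding z_def by blast
  qed
  show ?thesis
    unfolding has_derivative_within_alt using main mv.bounded_linear_right by blast
qed

section \<open>Derivatives within the corner simplex\<close>

text \<open>Segments from \<open>s\<close> to points \<open>c\<close> of the simplex stay inside it,
  so one-sided derivatives along them determine \<open>D (c - s)\<close>. Subtracting the case
  \<open>c = 0\<close> gives \<open>D c\<close>, and the unit vectors lie in the simplex. This
  identifies the derivative that \<open>frechet_derivative\<close> selects.\<close>

lemma has_derivative_corner_simplex_unique:
  fixes g :: "real^'k \<Rightarrow> 'a::real_normed_vector"
  assumes s: "s \<in> corner_simplex"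
    and D1: "(g has_derivative D1) (at s within corner_simplex)"
    and D2: "(g has_derivative D2) (at s within corner_simplex)"
  shows "D1 = D2"
proof -
  have eq: "D1 (c - s) = D2 (c - s)" if c: "c \<in> corner_simplex" for c
  proof -
    let ?l = "\<lambda>\<theta>::real. s + \<theta> *\<^sub>R (c - s)"
    have sub: "?l ` {0..1} \<subseteq> corner_simplex"
    proof
      fix u assume "u \<in> ?l ` {0..1}"
      then obtain \<theta> where \<theta>: "0 \<le> \<theta>" "\<theta> \<le> 1" "u = (1 - \<theta>) *\<^sub>R s + \<theta> *\<^sub>R c" by (auto simp: algebra_simps)
      have "(\<Sum>i\<in>UNIV. u $ i) = (1 - \<theta>) * (\<Sum>i\<in>UNIV. s $ i) + \<theta> * (\<Sum>i\<in>UNIV. c $ i)"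
        by (simp add: \<theta> sum.distrib sum_distrib_left)
      also have "\<dots> \<le> 1"
        using \<theta> s c by (intro convex_bound_le) (auto simp: corner_simplex_def)
      finally show "u \<in> corner_simplex"
        using \<theta> s c by (auto simp: corner_simplex_def)
    qed
    have l': "(?l has_vector_derivative c - s) (at 0 within {0..1})"
      by (auto intro!: derivative_eq_intros)
    have "((g \<circ> ?l) has_vector_derivative D (c - s)) (at 0 within {0..1})"
      if "(g has_derivative D) (at s within corner_simplex)" for D
    proof (rule vector_derivative_diff_chain_within[OF l'])
      show "(g has_derivative D) (at (?l 0) within ?l ` {0..1})"
        using has_derivative_subset[OF that sub] by simp
    qed
    from this[OF D1] this[OF D2] show ?thesis
      by (intro vector_derivative_unique_within) (auto simp: trivial_limit_within islimpt_Icc)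
  qed
  interpret D1: bounded_linear D1 using D1 by (rule has_derivative_bounded_linear)
  interpret D2: bounded_linear D2 using D2 by (rule has_derivative_bounded_linear)
  have "0 \<in> corner_simplex" by (simp add: corner_simplex_def)
  then have eq': "D1 c = D2 c" if "c \<in> corner_simplex" for c
    using eq[OF \<open>0 \<in> corner_simplex\<close>] eq[OF that] by (simp add: D1.diff D2.diff D1.neg D2.neg)
  have "axis i 1 \<in> corner_simplex" for i :: 'k
    by (simp add: corner_simplex_def axis_def)
  then have "D1 (axis i 1) = D2 (axis i 1)" for i by (rule eq')
  then have "D1 x = D2 x" for x
    by (subst (1 2) basis_expansion[of x, symmetric])
      (simp add: D1.sum D2.sum D1.scaleR D2.scaleR scalar_mult_eq_scaleR)
  then show ?thesis by blast
qed

lemma simplex_map_mem: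
  assumes "convex \<Omega>" "range a \<subseteq> \<Omega>" "b \<in> \<Omega>" "s \<in> corner_simplex"
  shows "simplex_map a b s \<in> \<Omega>"
proof -
  \<comment> \<open>The \<open>k + 1\<close> vertices are indexed by an option type, with
    \<open>None\<close> standing for the last vertex \<open>b\<close>.\<close>
  let ?c = "\<lambda>x. case x of None \<Rightarrow> 1 - (\<Sum>i\<in>UNIV. s $ i) | Some i \<Rightarrow> s $ i"
  let ?y = "\<lambda>x. case x of None \<Rightarrow> b | Some i \<Rightarrow> a i"
  have "(\<Sum>x\<in>UNIV. ?c x *\<^sub>R ?y x) \<in> \<Omega>"
    using assms by (intro convex_sum) (auto simp: corner_simplex_def UNIV_option_conv
      sum.reindex split: option.splits)
  then show ?thesis
    by (simp add: simplex_map_def UNIV_option_conv sum.reindex add.commute)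
qed

lemma simplex_map_has_derivative:
  "(simplex_map a b has_derivative (*v) (\<chi> j i. (a i - b) $ j)) (at s within S)"
proof -
  have "simplex_map a b = (\<lambda>u. b + (\<chi> j i. (a i - b) $ j) *v u)"
    by (simp add: fun_eq_iff vec_eq_iff simplex_map_def matrix_vector_mult_def algebra_simps
      sum.distrib sum_subtractf sum_distrib_left)
  then show ?thesis
    by (auto intro!: derivative_eq_intros bounded_linear_imp_has_derivative)
qed

section \<open>Deduction of k-contraction\<close>

theorem theorem9:
  fixes f :: "real \<Rightarrow> real^('n::{finite,linorder}) \<Rightarrow> real^('n::_)"
    and \<Omega> :: "(real^('n::_)) set"
    and \<eta> :: real
    and N :: "real^('r::{finite,linorder}) \<Rightarrow> real"
  assumes "CARD('n) \<ge> 2"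
    and "CARD('k::{finite,linorder}) \<in> {1..CARD('n) - 1}"
    and "CARD('r) = CARD('n) choose CARD('k)"
    and "\<And>t x. t \<ge> 0 \<Longrightarrow> f t differentiable (at x)"
    and "continuous_on ({0..} \<times> UNIV) (\<lambda>(t, x). jacobian (f t) (at x))"
    and "closed \<Omega>" and "convex \<Omega>"
    and "\<And>a. a \<in> \<Omega> \<Longrightarrow>
           \<exists>y. solves f a y \<and> (\<forall>z. solves f a z \<longrightarrow> (\<forall>t\<ge>0. z t = y t)) \<and> (\<forall>t\<ge>0. y t \<in> \<Omega>)"
    and "\<eta> > 0" and "is_vector_norm N"
    and "\<And>a t. a \<in> \<Omega> \<Longrightarrow> t \<ge> 0 \<Longrightarrow>
           matrix_measure N (additive_compound TYPE('k) (jacobian (f t) (at a))) \<le> - \<eta>"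
  shows "k_contractive TYPE('k) TYPE('r) f \<Omega>"
proof -
  let ?J = "\<lambda>t x. jacobian (f t) (at x)"
  have J: "(f t has_derivative (*v) (?J t x)) (at x)" if "0 \<le> t" for t x
    using assms(4)[OF that, of x] by (simp add: jacobian_works)
  define \<phi> where "\<phi> a = (SOME y. solves f a y)" for a
  have flow: "flow f t a = \<phi> a t" for t a
    by (simp add: flow_def \<phi>_def)
  have sol: "solves f a (\<phi> a)" if "a \<in> \<Omega>" for a
    unfolding \<phi>_def using assms(8)[OF that] by (metis someI)
  \<comment> \<open>Invariance is given for some solution; uniqueness transfers it to the chosen one
    at nonnegative times.\<close>
  have \<phi>_mem: "\<phi> a t \<in> \<Omega>" if "a \<in> \<Omega>" "0 \<le> t" for a t
    using assms(8)[OF that(1)] sol[OF that(1)] that(2) by metis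
  have "N (column 1 (compound TYPE('k) (W_matrix f a b T s) :: real^1^('r::_)))
      \<le> exp (- \<eta> * T) * N (column 1 (compound TYPE('k) (W_matrix f a b 0 s) :: real^1^('r::_)))"
    if ab: "range a \<subseteq> \<Omega>" "b \<in> \<Omega>" and s: "s \<in> corner_simplex" and T: "0 \<le> T"
    for a :: "'k \<Rightarrow> real^('n::_)" and b s T
  proof -
    define x where "x = simplex_map a b s"
    define H :: "real^('k::_)^('n::_)" where "H = (\<chi> j i. (a i - b) $ j)"
    have mem: "simplex_map a b u \<in> \<Omega>" if "u \<in> corner_simplex" for u
      using simplex_map_mem[OF assms(7) ab that] .
    have x: "x \<in> \<Omega>" using mem[OF s] by (simp add: x_def)
    have "continuous_on {0..T} ((\<lambda>(t, x). ?J t x) \<circ> (\<lambda>t. (t, \<phi> x t)))"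
    proof (rule continuous_on_compose)
      have "(\<phi> x has_vector_derivative f t (\<phi> x t)) (at t within {0..T})" if "t \<in> {0..T}" for t
        using sol[OF x] that unfolding solves_def
        by (intro has_vector_derivative_within_subset[of _ _ _ "{0..}" "{0..T}"]) auto
      then have "continuous_on {0..T} (\<phi> x)" by (rule continuous_on_vector_derivative)
      then show "continuous_on {0..T} (\<lambda>t. (t, \<phi> x t))" by (intro continuous_intros)
    qed (rule continuous_on_subset[OF assms(5)], auto)
    then have "continuous_on {0..T} (\<lambda>t. ?J t (\<phi> x t))" by (simp add: comp_def)
    from linear_ode_exists[OF bounded_bilinear_matrix_matrix_mult this T, of "mat 1"]
    obtain \<Phi> where \<Phi>: "\<Phi> 0 = mat 1"
      "\<And>t. t \<in> {0..T} \<Longrightarrow> (\<Phi> has_vector_derivative ?J t (\<phi> x t) ** \<Phi> t) (at t within {0..T})"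
      by metis
    \<comment> \<open>The chain rule applies within the simplex because its image lies in
      \<open>\<Omega>\<close>, where the flow has derivative \<open>\<Phi> t\<close>. Uniqueness
      then identifies the result with the derivative selected in \<open>W_matrix\<close>.\<close>
    have W: "W_matrix f a b t s = \<Phi> t ** H" if t: "t \<in> {0..T}" for t
    proof -
      have "((\<lambda>y. \<phi> y t) has_derivative (*v) (\<Phi> t)) (at x within \<Omega>)"
        by (rule has_derivative_initial_value[OF J assms(5) sol x T \<Phi> t])
      then have "((\<lambda>y. \<phi> y t) has_derivative (*v) (\<Phi> t)) (at x within simplex_map a b ` corner_simplex)"
        by (rule has_derivative_subset) (use mem in auto)
      from diff_chain_within[OF simplex_map_has_derivative[of a b s corner_simplex] this[unfolded x_def]]
      have D: "((\<lambda>u. flow f t (simplex_map a b u)) has_derivative (*v) (\<Phi> t ** H)) (at s within corner_simplex)"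
        by (simp add: comp_def flow H_def matrix_vector_mul_assoc)
      then have "((\<lambda>u. flow f t (simplex_map a b u)) has_derivative
          frechet_derivative (\<lambda>u. flow f t (simplex_map a b u)) (at s within corner_simplex))
          (at s within corner_simplex)"
        by (meson differentiableI frechet_derivative_works)
      from has_derivative_corner_simplex_unique[OF s this D] show ?thesis
        by (simp add: W_matrix_def)
    qed
    define y where "y t = column 1 (compound TYPE('k) (\<Phi> t ** H) :: real^1^('r::_))" for t
    have y': "(y has_vector_derivative additive_compound TYPE('k) (?J t (\<phi> x t)) *v y t)
        (at t within {0..T})" if t: "t \<in> {0..T}" for t
    proof -
      have "((\<lambda>t. \<Phi> t ** H) has_vector_derivative ?J t (\<phi> x t) ** (\<Phi> t ** H)) (at t within {0..T})"
        using bounded_linear.has_vector_derivative[OF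
          bounded_bilinear.bounded_linear_left[OF bounded_bilinear_matrix_matrix_mult] \<Phi>(2)[OF t]]
        by (simp add: matrix_mul_assoc)
      from column_compound_has_vector_derivative[OF assms(3) this]
      show ?thesis by (simp add: y_def[abs_def])
    qed
    have "N (y T) \<le> exp (- \<eta> * T) * N (y 0)"
    \<comment> \<open>The rate is \<open>- \<eta>\<close>: the trajectory stays in
      \<open>\<Omega>\<close>, so the measure bound holds along it at every time.\<close>
    proof (rule dini_gronwall[where g = "\<lambda>t. N (y t)" and T = T and \<delta> = 1])
      show "continuous_on {0..T} (\<lambda>t. N (y t))"
        by (rule continuous_on_compose2[OF vector_norm_continuous[OF assms(10), of UNIV]])
          (auto intro: continuous_on_vector_derivative y')
      fix t \<epsilon> :: real assume t: "0 \<le> t" "t < T" and "0 < \<epsilon>"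
      show "\<forall>\<^sub>F u in at_right t. N (y u) \<le> N (y t) + (u - t) * (- \<eta> * N (y t) + \<epsilon>)"
        using t by (intro vector_norm_dini[OF assms(10) has_vector_derivative_at_right[OF y']]
          assms(11) \<phi>_mem x \<open>0 < \<epsilon>\<close>) auto
    qed (use T in auto)
    then show ?thesis using T by (simp add: W y_def)
  qed
  then show ?thesis
    unfolding k_contractive_def using assms(9,10) by blast
qed

end
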